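(* Let $(U_n)_{n\in\omega}$ be a Fraïssé sequence in the category $\mathcal F$ of rational projection-embedding pairs (with bonding embeddings regarded as inclusions), and let $\mathbb P$ be the Banach space which is the completion of $\bigcup_{n\in\omega}U_n$. Then $\mathbb P$ has the following extension property: given a pair $E\subseteq F$ of finite-dimensional Banach spaces such that $E$ is $1$-complemented in $F$, and given a linear isometric embedding $i\colon E\to\mathbb P$ such that $i[E]$ is $1$-complemented in $\mathbb P$, for every $\varepsilon>0$ there exists an $\varepsilon$-isometric embedding $g\colon F\to\mathbb P$ such that $\|g\restriction E-i\|<\varepsilon$ and $g[F]$ is $(1,\varepsilon)$-complemented in $\mathbb P$.
   Context: All Banach spaces are real. An operator is $1$-bounded if it is linear of norm at most $1$. A subspace $Y$ of a Banach space $X$ is $1$-complemented in $X$ if there is a projection $P\colon X\to Y$ (so $Py=y$ for $y\in Y$) with $\|P\|\le 1$. For $\varepsilon>0$, $Y\subseteq X$ is $(1,\varepsilon)$-complemented in $X$ if there is a $1$-bounded operator $T\colon X\to Y$ with $\|Ty-y\|\le\varepsilon\|y\|$ for every $y\in Y$. For $\varepsilon>0$, an $\varepsilon$-isometric embedding (or $\varepsilon$-isometry) is a linear operator $f\colon X\to Y$ with $(1-\varepsilon)\|x\|\le\|f(x)\|\le\|x\|$ for all $x\in X$. The category $\mathcal F$: a Banach space is rational if it is $\mathbb R^n$ (for some $n\ge 0$) with a norm whose unit ball is the convex hull of finitely many vectors with all coordinates rational. A linear operator $T\colon\mathbb R^n\to\mathbb R^m$ is rational if $T[\mathbb Q^n]\subseteq\mathbb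 Q^m$. The objects of $\mathcal F$ are the rational Banach spaces; an $\mathcal F$-arrow from $E$ to $F$ is a pair $\langle e,P\rangle$ of rational $1$-bounded operators $e\colon E\to F$, $P\colon F\to E$ such that $e$ is an isometric embedding and $P\circ e=\mathrm{id}_E$. Composition: $\langle e',P'\rangle\circ\langle e,P\rangle=\langle e'\circ e,\,P\circ P'\rangle$. A sequence in $\mathcal F$ is a covariant functor from $(\omega,\le)$ to $\mathcal F$, i.e. objects $U_n$ with compatible bonding arrows $U_n\to U_m$ for $n\le m$. It is Fraïssé if: for every $n\in\omega$ and every $\mathcal F$-arrow $f\colon U_n\to Y$ there exist $m>n$ and an $\mathcal F$-arrow $g\colon Y\to U_m$ such that $g\circ f$ is the bonding arrow from $U_n$ to $U_m$. Such sequences exist. Identifying the bonding embeddings with inclusions, $(U_n)$ becomes an increasing chain of normed spaces, whose union is a normed space; $\mathbb P$ is its completion (the colimit of the chain in Banach spaces and isometric embeddings). *)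

theory Defs
  imports "HOL-Analysis.Analysis" "HOL-Analysis.Finite_Function_Topology"
begin

subsection \<open>Operators between subspaces\<close>

text \<open>Spaces are linear subspaces \<open>V\<close> of an ambient real vector space, with a norm \<open>N\<close> on \<open>V\<close>
  passed explicitly: the rational norms on \<open>\<real>\<^sup>n\<close> are not the type-class norm of the ambient type.
  Maps matter only on their domain.\<close>

definition linear_on :: "'a::real_vector set \<Rightarrow> 'b::real_vector set \<Rightarrow> ('a \<Rightarrow> 'b) \<Rightarrow> bool" where
  "linear_on V W f \<longleftrightarrow> f ` V \<subseteq> W \<and>
     (\<forall>x\<in>V. \<forall>y\<in>V. f (x + y) = f x + f y) \<and> (\<forall>c. \<forall>x\<in>V. f (c *\<^sub>R x) = c *\<^sub>R f x)"

definition norm_on :: "'a::real_vector set \<Rightarrow> ('a \<Rightarrow> real) \<Rightarrow> bool" where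
  "norm_on V N \<longleftrightarrow> (\<forall>x\<in>V. 0 \<le> N x \<and> (N x = 0 \<longleftrightarrow> x = 0)) \<and>
     (\<forall>x\<in>V. \<forall>y\<in>V. N (x + y) \<le> N x + N y) \<and> (\<forall>c. \<forall>x\<in>V. N (c *\<^sub>R x) = \<bar>c\<bar> * N x)"

definition one_bounded ::
  "'a::real_vector set \<Rightarrow> ('a \<Rightarrow> real) \<Rightarrow> 'b::real_vector set \<Rightarrow> ('b \<Rightarrow> real) \<Rightarrow> ('a \<Rightarrow> 'b) \<Rightarrow> bool" where
  "one_bounded V N W M f \<longleftrightarrow> linear_on V W f \<and> (\<forall>x\<in>V. M (f x) \<le> N x)"

definition isometric_embedding ::
  "'a::real_vector set \<Rightarrow> ('a \<Rightarrow> real) \<Rightarrow> 'b::real_vector set \<Rightarrow> ('b \<Rightarrow> real) \<Rightarrow> ('a \<Rightarrow> 'b) \<Rightarrow> bool" where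
  "isometric_embedding V N W M f \<longleftrightarrow> linear_on V W f \<and> (\<forall>x\<in>V. M (f x) = N x)"

text \<open>The remaining notions of this subsection refer to the ambient norm. As in \<^const>\<open>onorm\<close>,
  the quotient is \<open>0\<close> at \<open>x = 0\<close>; the supremum is only meaningful for bounded \<open>h\<close>.\<close>

definition onorm_on :: "'a::real_normed_vector set \<Rightarrow> ('a \<Rightarrow> 'b::real_normed_vector) \<Rightarrow> real" where
  "onorm_on V h = (SUP x\<in>V. norm (h x) / norm x)"

definition eps_isometric_embedding ::
  "real \<Rightarrow> 'a::real_normed_vector set \<Rightarrow> 'b::real_normed_vector set \<Rightarrow> ('a \<Rightarrow> 'b) \<Rightarrow> bool" where
  "eps_isometric_embedding \<epsilon> X Y f \<longleftrightarrow> linear_on X Y f \<and>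
     (\<forall>x\<in>X. (1 - \<epsilon>) * norm x \<le> norm (f x) \<and> norm (f x) \<le> norm x)"

definition one_complemented :: "'a::real_normed_vector set \<Rightarrow> 'a set \<Rightarrow> bool" where
  "one_complemented Y X \<longleftrightarrow> subspace Y \<and> Y \<subseteq> X \<and>
     (\<exists>T. one_bounded X norm Y norm T \<and> (\<forall>y\<in>Y. T y = y))"

definition one_eps_complemented :: "real \<Rightarrow> 'a::real_normed_vector set \<Rightarrow> 'a set \<Rightarrow> bool" where
  "one_eps_complemented \<epsilon> Y X \<longleftrightarrow> subspace Y \<and> Y \<subseteq> X \<and>
     (\<exists>T. one_bounded X norm Y norm T \<and> (\<forall>y\<in>Y. norm (T y - y) \<le> \<epsilon> * norm y))"

definition fin_dim_subspace :: "'a::real_vector set \<Rightarrow> bool" where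
  "fin_dim_subspace V \<longleftrightarrow> subspace V \<and> (\<exists>B. finite B \<and> span B = V)"

subsection \<open>The category of rational projection-embedding pairs\<close>

text \<open>\<open>\<real>\<^sup>n\<close> is the space of finitely supported real sequences vanishing from index \<open>n\<close> on. The type
  carries a norm in the library, which is not used.\<close>

type_synonym fvec = "nat \<Rightarrow>\<^sub>0 real"

definition Rn :: "nat \<Rightarrow> fvec set" where
  "Rn n = {x. \<forall>i\<ge>n. Poly_Mapping.lookup x i = 0}"

definition Qn :: "nat \<Rightarrow> fvec set" where
  "Qn n = {x \<in> Rn n. \<forall>i. Poly_Mapping.lookup x i \<in> \<rat>}"

record rspace =
  rdim :: nat
  rnorm :: "fvec \<Rightarrow> real"

abbreviation carr :: "rspace \<Rightarrow> fvec set" where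
  "carr E \<equiv> Rn (rdim E)"

definition rational_space :: "rspace \<Rightarrow> bool" where
  "rational_space E \<longleftrightarrow> norm_on (carr E) (rnorm E) \<and>
     (\<exists>A. finite A \<and> A \<subseteq> Qn (rdim E) \<and> {x \<in> carr E. rnorm E x \<le> 1} = convex hull A)"

definition rational_operator :: "rspace \<Rightarrow> rspace \<Rightarrow> (fvec \<Rightarrow> fvec) \<Rightarrow> bool" where
  "rational_operator E F T \<longleftrightarrow> linear_on (carr E) (carr F) T \<and> T ` Qn (rdim E) \<subseteq> Qn (rdim F)"

type_synonym arrow = "(fvec \<Rightarrow> fvec) \<times> (fvec \<Rightarrow> fvec)"

definition F_arrow :: "rspace \<Rightarrow> rspace \<Rightarrow> arrow \<Rightarrow> bool" where
  "F_arrow E F a \<longleftrightarrow>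
     rational_operator E F (fst a) \<and> rational_operator F E (snd a) \<and>
     one_bounded (carr E) (rnorm E) (carr F) (rnorm F) (fst a) \<and>
     one_bounded (carr F) (rnorm F) (carr E) (rnorm E) (snd a) \<and>
     isometric_embedding (carr E) (rnorm E) (carr F) (rnorm F) (fst a) \<and>
     (\<forall>x\<in>carr E. snd a (fst a x) = x)"

definition F_id :: arrow where
  "F_id = (id, id)"

definition F_comp :: "arrow \<Rightarrow> arrow \<Rightarrow> arrow" where
  "F_comp b a = (fst b \<circ> fst a, snd a \<circ> snd b)"

text \<open>Equality of arrows from \<open>E\<close> to \<open>F\<close>: values outside the carriers are ignored.\<close>

definition F_eq :: "rspace \<Rightarrow> rspace \<Rightarrow> arrow \<Rightarrow> arrow \<Rightarrow> bool" where
  "F_eq E F a b \<longleftrightarrow> (\<forall>x\<in>carr E. fst a x = fst b x) \<and> (\<forall>y\<in>carr F. snd a y = snd b y)"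

definition F_sequence :: "(nat \<Rightarrow> rspace) \<Rightarrow> (nat \<Rightarrow> nat \<Rightarrow> arrow) \<Rightarrow> bool" where
  "F_sequence U u \<longleftrightarrow>
     (\<forall>n. rational_space (U n)) \<and>
     (\<forall>n m. n \<le> m \<longrightarrow> F_arrow (U n) (U m) (u n m)) \<and>
     (\<forall>n. F_eq (U n) (U n) (u n n) F_id) \<and>
     (\<forall>n m k. n \<le> m \<longrightarrow> m \<le> k \<longrightarrow> F_eq (U n) (U k) (F_comp (u m k) (u n m)) (u n k))"

definition fraisse_sequence :: "(nat \<Rightarrow> rspace) \<Rightarrow> (nat \<Rightarrow> nat \<Rightarrow> arrow) \<Rightarrow> bool" where
  "fraisse_sequence U u \<longleftrightarrow> F_sequence U u \<and>
     (\<forall>n Y f. rational_space Y \<and> F_arrow (U n) Y f \<longrightarrow>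
        (\<exists>m>n. \<exists>g. F_arrow Y (U m) g \<and> F_eq (U n) (U m) (F_comp g f) (u n m)))"

text \<open>\<open>P\<close> is a completion of the union of the chain, with canonical embeddings \<open>j n\<close>. It is
  a closed subspace of an ambient Banach space rather than a whole type, so that a suitable type
  exists for every sequence (for instance \<open>nat \<Rightarrow>\<^sub>C real\<close>, which contains every separable Banach
  space isometrically).\<close>

definition chain_completion ::
  "(nat \<Rightarrow> rspace) \<Rightarrow> (nat \<Rightarrow> nat \<Rightarrow> arrow) \<Rightarrow> (nat \<Rightarrow> fvec \<Rightarrow> 'p::banach) \<Rightarrow> 'p set \<Rightarrow> bool" where
  "chain_completion U u j P \<longleftrightarrow>
     (\<forall>n. isometric_embedding (carr (U n)) (rnorm (U n)) P norm (j n)) \<and>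
     (\<forall>n m. n \<le> m \<longrightarrow> (\<forall>x\<in>carr (U n). j m (fst (u n m) x) = j n x)) \<and>
     P = closure (\<Union>n. j n ` carr (U n))"

end

theory Submission
  imports Defs
begin

text \<open>Approximate \<open>i\<close> by a \<open>1\<close>-bounded \<open>e: E \<rightarrow> U\<^sub>n\<close>. A \<open>1\<close>-bounded retraction
  of \<open>\<P>\<close> onto \<open>i[E]\<close> yields a \<open>1\<close>-bounded \<open>p: U\<^sub>n \<rightarrow> E\<close> with
  \<open>p e\<close> close to the identity. Let \<open>\<pi>: F \<rightarrow> E\<close> be the given projection. In \<open>U\<^sub>n \<oplus> F\<close> with the
  maximum norm, \<open>w \<mapsto> (w, p w)\<close> and \<open>x \<mapsto> (e \<pi> x, x)\<close> are isometric embeddings of \<open>U\<^sub>n\<close>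
  and \<open>F\<close> which almost agree along \<open>e\<close>, and both ranges are \<open>1\<close>-complemented by the coordinate
  projections. The shear \<open>(w, y) \<mapsto> (w, y - p w)\<close> turns the embedding of \<open>U\<^sub>n\<close> and its
  projection into coordinate maps, which are rational. It then suffices to replace the unit
  ball by the convex hull of that of \<open>U\<^sub>n\<close> and a rational polytope close to the ball, and to apply
  the Fraisse property to the resulting rational space. The operator onto \<open>F\<close> is
  extended to \<open>\<P>\<close> by density, through the projections of the sequence.\<close>

section \<open>Linear maps and norms on subspaces\<close>

lemma linear_on_mem: "linear_on V W f \<Longrightarrow> x \<in> V \<Longrightarrow> f x \<in> W"
  by (auto simp: linear_on_def)

lemma linear_on_add: "linear_on V W f \<Longrightarrow> x \<in> V \<Longrightarrow> y \<in> V \<Longrightarrow> f (x + y) = f x + f y"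
  by (auto simp: linear_on_def)

lemma linear_on_scale: "linear_on V W f \<Longrightarrow> x \<in> V \<Longrightarrow> f (c *\<^sub>R x) = c *\<^sub>R f x"
  by (auto simp: linear_on_def)

lemma linear_onI:
  assumes "\<And>x. x \<in> V \<Longrightarrow> f x \<in> W"
    and "\<And>x y. x \<in> V \<Longrightarrow> y \<in> V \<Longrightarrow> f (x + y) = f x + f y"
    and "\<And>c x. x \<in> V \<Longrightarrow> f (c *\<^sub>R x) = c *\<^sub>R f x"
  shows "linear_on V W f"
  using assms by (auto simp: linear_on_def)

lemma linear_imp_linear_on: "linear f \<Longrightarrow> f ` V \<subseteq> W \<Longrightarrow> linear_on V W f"
  by (auto simp: linear_on_def linear_add linear_scale)

lemma linear_on_zero:
  assumes "linear_on V W f" "subspace V" shows "f 0 = 0"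
  using linear_on_scale[OF assms(1) subspace_0[OF assms(2)], of 0] by simp

lemma linear_on_diff:
  assumes "linear_on V W f" "subspace V" "x \<in> V" "y \<in> V"
  shows "f (x - y) = f x - f y"
proof -
  have "f (x + (-1) *\<^sub>R y) = f x + (-1) *\<^sub>R f y"
    using assms by (metis linear_on_add linear_on_scale subspace_scale)
  then show ?thesis by simp
qed

lemma linear_on_sum:
  assumes "linear_on V W f" "subspace V" "\<And>a. a \<in> A \<Longrightarrow> g a \<in> V"
  shows "f (\<Sum>a\<in>A. g a) = (\<Sum>a\<in>A. f (g a))"
  using assms(3)
proof (induction A rule: infinite_finite_induct)
  case (insert a A)
  then show ?case
    using assms by (simp add: linear_on_add subspace_sum)
qed (auto simp: linear_on_zero[OF assms(1,2)])

lemma linear_on_compose: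
  assumes "linear_on V W f" "linear_on W X g" shows "linear_on V X (\<lambda>x. g (f x))"
  using assms by (auto simp: linear_on_def image_subset_iff)

lemma linear_on_scaled:
  assumes "linear_on V W f" "subspace W" shows "linear_on V W (\<lambda>x. c *\<^sub>R f x)"
  using assms by (auto simp: linear_on_def image_subset_iff subspace_scale scaleR_add_right)

lemma linear_on_plus:
  assumes "linear_on V W f" "linear_on V W g" "subspace W"
  shows "linear_on V W (\<lambda>x. f x + g x)"
  using assms by (auto simp: linear_on_def image_subset_iff subspace_add scaleR_add_right)

lemma linear_on_minus:
  assumes "linear_on V W f" "linear_on V W g" "subspace W"
  shows "linear_on V W (\<lambda>x. f x - g x)"
  using assms by (auto simp: linear_on_def image_subset_iff subspace_diff scaleR_diff_right)

lemma linear_on_subset: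
  assumes "linear_on V W f" "V' \<subseteq> V" "W \<subseteq> W'" shows "linear_on V' W' f"
  using assms(2,3)
  by (intro linear_onI) (blast intro: linear_on_mem[OF assms(1)] linear_on_add[OF assms(1)]
      linear_on_scale[OF assms(1)])+

lemma subspace_image_linear_on:
  assumes "linear_on V W f" "subspace V" shows "subspace (f ` V)"
proof (rule subspaceI)
  show "0 \<in> f ` V"
    using linear_on_zero[OF assms] subspace_0[OF assms(2)] by (metis imageI)
  show "x + y \<in> f ` V" if "x \<in> f ` V" "y \<in> f ` V" for x y
    using that assms by (auto simp: linear_on_add[OF assms(1), symmetric] subspace_add)
  show "c *\<^sub>R x \<in> f ` V" if "x \<in> f ` V" for x c
    using that assms by (auto simp: linear_on_scale[OF assms(1), symmetric] subspace_scale)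
qed

lemma norm_on_ge_0: "norm_on V N \<Longrightarrow> x \<in> V \<Longrightarrow> 0 \<le> N x"
  by (auto simp: norm_on_def)

lemma norm_on_eq_0: "norm_on V N \<Longrightarrow> x \<in> V \<Longrightarrow> N x = 0 \<longleftrightarrow> x = 0"
  by (auto simp: norm_on_def)

lemma norm_on_triangle: "norm_on V N \<Longrightarrow> x \<in> V \<Longrightarrow> y \<in> V \<Longrightarrow> N (x + y) \<le> N x + N y"
  by (auto simp: norm_on_def)

lemma norm_on_scale: "norm_on V N \<Longrightarrow> x \<in> V \<Longrightarrow> N (c *\<^sub>R x) = \<bar>c\<bar> * N x"
  by (auto simp: norm_on_def)

lemma norm_on_sum:
  assumes "norm_on V N" "subspace V" "\<And>a. a \<in> A \<Longrightarrow> g a \<in> V"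
  shows "N (\<Sum>a\<in>A. g a) \<le> (\<Sum>a\<in>A. N (g a))"
  using assms(3)
proof (induction A rule: infinite_finite_induct)
  case (insert a A)
  then have "N (g a + (\<Sum>a\<in>A. g a)) \<le> N (g a) + N (\<Sum>a\<in>A. g a)"
    by (intro norm_on_triangle[OF assms(1)] subspace_sum[OF assms(2)]) auto
  with insert show ?case by fastforce
qed (use norm_on_eq_0[OF assms(1) subspace_0[OF assms(2)]] in auto)

lemma norm_on_diff_commute:
  assumes "norm_on V N" "subspace V" "x \<in> V" "y \<in> V"
  shows "N (x - y) = N (y - x)"
  using norm_on_scale[OF assms(1), of "x - y" "-1"] assms by (simp add: subspace_diff)

lemma norm_on_diff_le:
  assumes "norm_on V N" "subspace V" "x \<in> V" "y \<in> V"
  shows "\<bar>N x - N y\<bar> \<le> N (x - y)"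
  using norm_on_triangle[OF assms(1), of "x - y" y] norm_on_triangle[OF assms(1), of "y - x" x]
    norm_on_diff_commute[OF assms] assms by (auto simp: subspace_diff)

lemma norm_on_norm: "norm_on V norm"
  by (auto simp: norm_on_def norm_triangle_ineq)

lemma norm_on_pullback:
  assumes "linear_on V W f" "subspace V" "norm_on W N" "inj_on f V"
  shows "norm_on V (\<lambda>x. N (f x))"
proof -
  have "f x = 0 \<longleftrightarrow> x = 0" if "x \<in> V" for x
    using inj_onD[OF assms(4), of x 0] linear_on_zero[OF assms(1,2)] that subspace_0[OF assms(2)] by auto
  then show ?thesis
    using assms(1,3) by (auto simp: norm_on_def linear_on_def image_subset_iff)
qed

text \<open>Pulls the maximum norm of a direct sum back along the pair of \<open>f\<close> and
  \<open>h\<close>, which is injective by the kernel condition. It produces the norm of the amalgam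
  in sheared coordinates.\<close>

lemma norm_on_max:
  assumes "linear_on V X f" "norm_on X M" "linear_on V W h" "norm_on W K"
    and "\<And>x. x \<in> V \<Longrightarrow> f x = 0 \<Longrightarrow> h x = 0 \<Longrightarrow> x = 0" and "subspace V"
  shows "norm_on V (\<lambda>x. max (M (f x)) (K (h x)))"
  unfolding norm_on_def
proof (intro conjI ballI allI)
  fix x assume x: "x \<in> V"
  have m: "f x \<in> X" "h x \<in> W" using assms(1,3) x by (auto simp: linear_on_def)
  then have g: "0 \<le> M (f x)" "0 \<le> K (h x)"
    using assms(2,4) by (auto simp: norm_on_def)
  then show "0 \<le> max (M (f x)) (K (h x))" by auto
  have "max (M (f x)) (K (h x)) = 0 \<longleftrightarrow> M (f x) = 0 \<and> K (h x) = 0"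
    using g by linarith
  also have "\<dots> \<longleftrightarrow> f x = 0 \<and> h x = 0"
    using m norm_on_eq_0[OF assms(2)] norm_on_eq_0[OF assms(4)] by simp
  also have "\<dots> \<longleftrightarrow> x = 0"
    using assms(5)[OF x] linear_on_zero[OF assms(1,6)] linear_on_zero[OF assms(3,6)] by auto
  finally show "max (M (f x)) (K (h x)) = 0 \<longleftrightarrow> x = 0" .
  show "max (M (f (c *\<^sub>R x))) (K (h (c *\<^sub>R x))) = \<bar>c\<bar> * max (M (f x)) (K (h x))" for c
    using m x assms by (simp add: linear_on_scale[OF assms(1)] linear_on_scale[OF assms(3)]
        norm_on_scale[OF assms(2)] norm_on_scale[OF assms(4)] max_mult_distrib_left)
  fix y assume y: "y \<in> V"
  have m': "f y \<in> X" "h y \<in> W" using assms(1,3) y by (auto simp: linear_on_def)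
  show "max (M (f (x + y))) (K (h (x + y)))
      \<le> max (M (f x)) (K (h x)) + max (M (f y)) (K (h y))"
    unfolding linear_on_add[OF assms(1) x y] linear_on_add[OF assms(3) x y]
    using norm_on_triangle[OF assms(2) m(1) m'(1)] norm_on_triangle[OF assms(4) m(2) m'(2)]
    by linarith
qed

section \<open>The coordinate spaces \<open>Rn n\<close> and equivalence of norms on them\<close>

lemma lookup_scaleR [simp]:
  "Poly_Mapping.lookup (c *\<^sub>R x) k = c *\<^sub>R Poly_Mapping.lookup x k"
  by (simp add: scaleR_poly_mapping_def)

lemma subspace_Rn: "subspace (Rn n)"
  by (auto simp: subspace_def Rn_def lookup_add)

lemma single_in_Rn: "k < n \<Longrightarrow> Poly_Mapping.single k c \<in> Rn n"
  by (auto simp: Rn_def lookup_single when_def)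

lemma Rn_mono: "m \<le> n \<Longrightarrow> Rn m \<subseteq> Rn n"
  by (auto simp: Rn_def)

lemma lookup_lincomb:
  fixes n l :: nat
  shows "Poly_Mapping.lookup (\<Sum>k<n. c k *\<^sub>R Poly_Mapping.single k (1::real)) l = (if l < n then c l else 0)"
proof -
  have "Poly_Mapping.lookup (\<Sum>k<n. c k *\<^sub>R Poly_Mapping.single k (1::real)) l
     = (\<Sum>k<n. if k = l then c k else 0)"
    unfolding lookup_sum by (rule sum.cong) (auto simp: lookup_single when_def)
  also have "\<dots> = (if l < n then c l else 0)"
    by (subst sum.delta) auto
  finally show ?thesis .
qed

lemma lincomb_in_Rn: "(\<Sum>k<n. c k *\<^sub>R Poly_Mapping.single k (1::real)) \<in> Rn n"
  by (simp add: Rn_def lookup_lincomb)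

lemma Rn_expansion:
  assumes "x \<in> Rn n"
  shows "(\<Sum>k<n. Poly_Mapping.lookup x k *\<^sub>R Poly_Mapping.single k 1) = x"
  by (rule poly_mapping_eqI) (use assms in \<open>auto simp: lookup_lincomb Rn_def\<close>)

text \<open>The norm carried by finitely supported functions is the sum norm, and indices outside
  the support add zeros. It serves below as the auxiliary reference norm on
  \<open>Rn n\<close>.\<close>

lemma norm_Rn:
  assumes "x \<in> Rn n"
  shows "norm x = (\<Sum>k<n. \<bar>Poly_Mapping.lookup x k\<bar>)"
proof -
  have "norm x = (\<Sum>k\<in>Poly_Mapping.keys x. \<bar>Poly_Mapping.lookup x k\<bar>)"
    by (simp add: norm_poly_mapping_def dist_poly_mapping_def)
  also have "\<dots> = (\<Sum>k<n. \<bar>Poly_Mapping.lookup x k\<bar>)"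
  proof (rule sum.mono_neutral_left)
    show "Poly_Mapping.keys x \<subseteq> {..<n}"
      using assms by (metis (mono_tags, lifting) Rn_def in_keys_iff lessThan_iff mem_Collect_eq not_less subsetI)
  qed (auto simp: in_keys_iff)
  finally show ?thesis .
qed

lemma abs_lookup_le_norm: "\<bar>Poly_Mapping.lookup x k\<bar> \<le> norm (x :: fvec)"
proof (cases "k \<in> Poly_Mapping.keys x")
  case True
  have "norm x = (\<Sum>k\<in>Poly_Mapping.keys x. \<bar>Poly_Mapping.lookup x k\<bar>)"
    by (simp add: norm_poly_mapping_def dist_poly_mapping_def)
  then show ?thesis
    using member_le_sum[OF True, of "\<lambda>k. \<bar>Poly_Mapping.lookup x k\<bar>"] by simp
qed (simp add: in_keys_iff)

lemma norm_single_one [simp]: "norm (Poly_Mapping.single k 1 :: fvec) = 1"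
  using norm_Rn[OF single_in_Rn[OF lessI, of k 1]] by (simp add: lookup_single when_def)

text \<open>Triangle inequality on the expansion in unit vectors. Adding 1 to the sum of their norms
  keeps the constant positive even for \<open>n = 0\<close>.\<close>

lemma norm_on_le_norm:
  assumes "norm_on (Rn n) N"
  obtains C where "C > 0" "\<And>x. x \<in> Rn n \<Longrightarrow> N x \<le> C * norm x"
proof
  let ?S = "\<Sum>k<n. N (Poly_Mapping.single k 1)"
  have nn: "0 \<le> N (Poly_Mapping.single k 1)" if "k < n" for k
    using norm_on_ge_0[OF assms single_in_Rn[OF that]] .
  then have S: "0 \<le> ?S" by (auto intro: sum_nonneg)
  then show "?S + 1 > 0" by simp
  fix x assume x: "x \<in> Rn n"
  have "N x \<le> (\<Sum>k<n. N (Poly_Mapping.lookup x k *\<^sub>R Poly_Mapping.single k 1))"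
    using norm_on_sum[OF assms subspace_Rn, of "{..<n}" "\<lambda>k. Poly_Mapping.lookup x k *\<^sub>R Poly_Mapping.single k 1"]
    by (simp add: Rn_expansion[OF x] subspace_scale[OF subspace_Rn] single_in_Rn)
  also have "\<dots> = (\<Sum>k<n. \<bar>Poly_Mapping.lookup x k\<bar> * N (Poly_Mapping.single k 1))"
    by (intro sum.cong refl norm_on_scale[OF assms] single_in_Rn) auto
  also have "\<dots> \<le> (\<Sum>k<n. norm x * N (Poly_Mapping.single k 1))"
    by (intro sum_mono mult_right_mono abs_lookup_le_norm nn) auto
  also have "\<dots> = ?S * norm x" by (simp add: sum_distrib_left mult.commute)
  also have "\<dots> \<le> (?S + 1) * norm x" by (simp add: algebra_simps)
  finally show "N x \<le> (?S + 1) * norm x" .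
qed

text \<open>These span the unit ball of the sum norm. The origin is included so that the set is
  nonempty for \<open>n = 0\<close> and can absorb the missing weight of vectors of norm below
  1.\<close>

definition cross_vertices :: "nat \<Rightarrow> fvec set" where
  "cross_vertices n = insert 0 ((\<lambda>k. Poly_Mapping.single k 1) ` {..<n} \<union> (\<lambda>k. - Poly_Mapping.single k 1) ` {..<n})"

lemma finite_cross_vertices: "finite (cross_vertices n)"
  by (simp add: cross_vertices_def)

lemma cross_vertices_subset_Rn: "cross_vertices n \<subseteq> Rn n"
  by (auto simp: cross_vertices_def single_in_Rn subspace_Rn subspace_neg subspace_0)

text \<open>The absolute values of the coordinates are the weights, placed on unit vectors of
  matching sign. They add up to \<open>norm x\<close>, and the origin takes the rest.\<close>

lemma Rn_cball_subset_hull: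
  assumes "x \<in> Rn n" "norm x \<le> 1"
  shows "x \<in> convex hull (cross_vertices n)"
proof -
  have hull: "s *\<^sub>R Poly_Mapping.single k 1 \<in> convex hull (cross_vertices n)" if "k < n" "s = 1 \<or> s = -1" for k s
    using that by (intro hull_inc) (auto simp: cross_vertices_def)
  have "(\<Sum>k<n. \<bar>Poly_Mapping.lookup x k\<bar> *\<^sub>R ((if 0 \<le> Poly_Mapping.lookup x k then 1 else -1) *\<^sub>R Poly_Mapping.single k 1))
      + (1 - norm x) *\<^sub>R 0 \<in> convex hull (cross_vertices n)" (is "?s + _ \<in> _")
  proof -
    \<comment> \<open>Index \<open>n\<close> is reserved for the origin, so that a single family of
      weights with sum 1 results.\<close>
    define y where "y k = (if k < n then (if 0 \<le> Poly_Mapping.lookup x k then 1 else -1) *\<^sub>R Poly_Mapping.single k 1 else (0::fvec))" for k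
    define a where "a k = (if k < n then \<bar>Poly_Mapping.lookup x k\<bar> else 1 - norm x)" for k
    have "(\<Sum>k<Suc n. a k *\<^sub>R y k) \<in> convex hull (cross_vertices n)"
    proof (rule convex_sum)
      show "sum a {..<Suc n} = 1" by (simp add: a_def norm_Rn[OF assms(1)])
      show "y k \<in> convex hull (cross_vertices n)" if "k \<in> {..<Suc n}" for k
        unfolding y_def using hull[of k] by (auto intro: hull_inc simp: cross_vertices_def)
    qed (use assms in \<open>auto simp: a_def\<close>)
    then show ?thesis by (simp add: a_def y_def)
  qed
  moreover have "?s = x"
    by (subst Rn_expansion[OF assms(1), symmetric]) (rule sum.cong, auto)
  ultimately show ?thesis by simp
qed

text \<open>\<open>N\<close> is Lipschitz for the sum norm, so it has a positive minimum on the unit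
  sphere, whose reciprocal is the constant. The ambient type is infinite-dimensional; compactness of
  the sphere comes from the hull of finitely many vertices.\<close>

lemma norm_le_norm_on:
  assumes N: "norm_on (Rn n) N"
  obtains C where "C > 0" "\<And>x. x \<in> Rn n \<Longrightarrow> norm x \<le> C * N x"
proof -
  have AR: "convex hull (cross_vertices n) \<subseteq> Rn n"
    by (rule hull_minimal[OF cross_vertices_subset_Rn]) (simp add: subspace_Rn subspace_imp_convex)
  define S where "S = convex hull (cross_vertices n) \<inter> {x. norm x = 1}"
  have S: "x \<in> S" if "x \<in> Rn n" "norm x = 1" for x
    using that Rn_cball_subset_hull[OF that(1)] by (auto simp: S_def)
  have SR: "S \<subseteq> Rn n" using AR by (auto simp: S_def)
  have "compact S"
    unfolding S_def
    by (intro compact_Int_closed finite_imp_compact_convex_hull closed_Collect_eq continuous_intros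
        finite_cross_vertices)
  obtain C0 where C0: "C0 > 0" "\<And>x. x \<in> Rn n \<Longrightarrow> N x \<le> C0 * norm x"
    using norm_on_le_norm[OF N] by blast
  have "C0-lipschitz_on S N"
  proof (rule lipschitz_onI)
    fix x y assume "x \<in> S" "y \<in> S"
    then have xy: "x \<in> Rn n" "y \<in> Rn n" using SR by auto
    then have "\<bar>N x - N y\<bar> \<le> N (x - y)"
      by (rule norm_on_diff_le[OF N subspace_Rn])
    also have "\<dots> \<le> C0 * norm (x - y)" by (intro C0 subspace_diff subspace_Rn xy)
    finally show "dist (N x) (N y) \<le> C0 * dist x y" by (simp add: dist_norm)
  qed (use C0 in auto)
  then have cont: "continuous_on S N" by (rule lipschitz_on_continuous_on)
  show thesis
  proof (cases "S = {}")
    case True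
    \<comment> \<open>With an empty sphere only the zero vector is left.\<close>
    have "norm x \<le> 1 * N x" if x: "x \<in> Rn n" for x
    proof (cases "x = 0")
      case False
      then have "(1 / norm x) *\<^sub>R x \<in> S" using x by (intro S subspace_scale subspace_Rn) auto
      with True show ?thesis by auto
    qed (use norm_on_ge_0[OF N x] in auto)
    then show ?thesis by (rule that[rotated]) auto
  next
    case False
    then obtain a where a: "a \<in> S" "\<And>y. y \<in> S \<Longrightarrow> N a \<le> N y"
      using continuous_attains_inf[OF \<open>compact S\<close> False cont] by auto
    have "a \<noteq> 0" using a(1) by (auto simp: S_def)
    then have Na: "N a > 0"
      using norm_on_ge_0[OF N, of a] norm_on_eq_0[OF N, of a] a(1) SR by fastforce
    show ?thesis
    proof (rule that[of "1 / N a"])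
      fix x assume x: "x \<in> Rn n"
      show "norm x \<le> 1 / N a * N x"
      proof (cases "x = 0")
        case False
        then have "N a \<le> N ((1 / norm x) *\<^sub>R x)" using x by (intro a S subspace_scale subspace_Rn) auto
        also have "\<dots> = N x / norm x" using norm_on_scale[OF N x] by simp
        finally show ?thesis using False Na by (simp add: field_simps)
      qed (use norm_on_ge_0[OF N x] Na in auto)
    qed (use Na in auto)
  qed
qed

section \<open>Finite-dimensional subspaces and extension by density\<close>

text \<open>A basis is selected from the finite spanning set and numbered from 0. The resulting
  isomorphism transfers norm estimates from \<open>Rn k\<close> to subspaces of arbitrary
  spaces.\<close>

lemma fin_dim_coordinates:
  fixes V :: "'a::real_vector set"
  assumes "fin_dim_subspace V"
  obtains k \<phi> \<kappa> where "linear_on (Rn k) V \<phi>" "linear_on V (Rn k) \<kappa>"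
    "\<And>z. z \<in> Rn k \<Longrightarrow> \<kappa> (\<phi> z) = z" "\<And>y. y \<in> V \<Longrightarrow> \<phi> (\<kappa> y) = y"
proof -
  obtain B0 where B0: "finite B0" "span B0 = V"
    using assms by (auto simp: fin_dim_subspace_def)
  obtain B where B: "B \<subseteq> B0" "independent B" "B0 \<subseteq> span B"
    using maximal_independent_subset[of B0] by metis
  have fin: "finite B" using B B0 finite_subset by blast
  have spB: "span B = V"
    using B B0 by (metis span_mono span_span subset_antisym)
  obtain h where h: "bij_betw h {..<card B} B"
    using ex_bij_betw_nat_finite[OF fin] by (auto simp: atLeast0LessThan)
  define k where "k = card B"
  define \<phi> where "\<phi> z = (\<Sum>l<k. Poly_Mapping.lookup z l *\<^sub>R h l)" for z
  define \<kappa> where "\<kappa> y = (\<Sum>l<k. representation B y (h l) *\<^sub>R Poly_Mapping.single l (1::real))" for y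
  have hB: "h l \<in> B" if "l < k" for l
    using h that by (auto simp: k_def bij_betw_def)
  have h_eq: "h l = h l' \<longleftrightarrow> l = l'" if "l < k" "l' < k" for l l'
    using h that by (auto simp: k_def bij_betw_def inj_on_def)
  have hs: "h l \<in> span B" if "l < k" for l
    using hB[OF that] by (rule span_base)
  have rep\<phi>: "representation B (\<phi> z) (h l) = Poly_Mapping.lookup z l" if "l < k" for l z
  proof -
    have "representation B (\<phi> z) (h l) = (\<Sum>m<k. representation B (Poly_Mapping.lookup z m *\<^sub>R h m) (h l))"
      unfolding \<phi>_def by (subst representation_sum[OF B(2)]) (auto intro: span_scale hs)
    also have "\<dots> = (\<Sum>m<k. if m = l then Poly_Mapping.lookup z m else 0)"
      by (rule sum.cong)
        (use that in \<open>auto simp: representation_scale[OF B(2) hs] representation_basis[OF B(2) hB] h_eq\<close>)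
    also have "\<dots> = Poly_Mapping.lookup z l" using that by (subst sum.delta) auto
    finally show ?thesis .
  qed
  show thesis
  proof (rule that)
    show "linear_on (Rn k) V \<phi>"
    proof (rule linear_onI)
      show "\<phi> x \<in> V" for x
        unfolding \<phi>_def spB[symmetric] by (intro span_sum span_scale hs) auto
    qed (simp_all add: \<phi>_def lookup_add scaleR_add_left sum.distrib scaleR_sum_right)
    show "linear_on V (Rn k) \<kappa>"
    proof (rule linear_onI)
      show "\<kappa> x \<in> Rn k" for x unfolding \<kappa>_def by (rule lincomb_in_Rn)
    qed (simp_all add: \<kappa>_def spB representation_add[OF B(2)] representation_scale[OF B(2)]
        scaleR_add_left sum.distrib scaleR_sum_right)
    show "\<kappa> (\<phi> z) = z" if "z \<in> Rn k" for z
    proof -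
      have "\<kappa> (\<phi> z) = (\<Sum>l<k. Poly_Mapping.lookup z l *\<^sub>R Poly_Mapping.single l 1)"
        unfolding \<kappa>_def by (rule sum.cong) (auto simp: rep\<phi>)
      then show ?thesis by (simp add: Rn_expansion[OF that])
    qed
    show "\<phi> (\<kappa> y) = y" if "y \<in> V" for y
    proof -
      have "\<phi> (\<kappa> y) = (\<Sum>l<k. representation B y (h l) *\<^sub>R h l)"
        unfolding \<phi>_def \<kappa>_def by (rule sum.cong) (auto simp: lookup_lincomb)
      also have "\<dots> = (\<Sum>b\<in>B. representation B y b *\<^sub>R b)"
        using sum.reindex_bij_betw[OF h, of "\<lambda>b. representation B y b *\<^sub>R b"] by (simp add: k_def)
      also have "\<dots> = y"
        using sum_representation_eq[OF B(2) _ fin order_refl] that spB by auto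
      finally show ?thesis .
    qed
  qed
qed

text \<open>The norm pulled back along \<open>\<phi>\<close> is a norm on \<open>Rn k\<close>, hence
  dominates the sum norm up to a constant.\<close>

lemma coordinates_bounded:
  fixes V :: "'a::real_normed_vector set"
  assumes "linear_on (Rn k) V \<phi>" "linear_on V (Rn k) \<kappa>"
    "\<And>z. z \<in> Rn k \<Longrightarrow> \<kappa> (\<phi> z) = z" "\<And>y. y \<in> V \<Longrightarrow> \<phi> (\<kappa> y) = y"
  obtains C where "C > 0" "\<And>y. y \<in> V \<Longrightarrow> norm (\<kappa> y) \<le> C * norm y"
proof -
  have "norm_on (Rn k) (\<lambda>z. norm (\<phi> z))"
    using assms(1) subspace_Rn norm_on_norm
    by (rule norm_on_pullback) (metis assms(3) inj_onI)
  then obtain C where "C > 0" "\<And>z. z \<in> Rn k \<Longrightarrow> norm z \<le> C * norm (\<phi> z)"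
    by (rule norm_le_norm_on) blast
  with that show thesis by (metis assms(2,4) linear_on_mem)
qed

text \<open>Every bounded part of \<open>V\<close> lies in a compact subset of \<open>V\<close>, the
  linear image of a dilated cross-polytope. A convergent sequence is bounded, so its limit stays in
  one of these sets.\<close>

lemma closed_fin_dim_subspace:
  fixes V :: "'a::real_normed_vector set"
  assumes "fin_dim_subspace V"
  shows "closed V"
proof -
  have V: "subspace V" using assms by (simp add: fin_dim_subspace_def)
  obtain k \<phi> \<kappa> where c: "linear_on (Rn k) V \<phi>" "linear_on V (Rn k) \<kappa>"
    "\<And>z. z \<in> Rn k \<Longrightarrow> \<kappa> (\<phi> z) = z" "\<And>y. y \<in> V \<Longrightarrow> \<phi> (\<kappa> y) = y"
    using fin_dim_coordinates[OF assms] by metis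
  obtain C where C: "C > 0" "\<And>y. y \<in> V \<Longrightarrow> norm (\<kappa> y) \<le> C * norm y"
    using coordinates_bounded[OF c] by blast
  define A where "A = cross_vertices k"
  have AR: "A \<subseteq> Rn k" unfolding A_def by (rule cross_vertices_subset_Rn)
  have fA: "finite A" unfolding A_def by (rule finite_cross_vertices)
  define K where "K r = (\<lambda>x. r *\<^sub>R x) ` (convex hull (\<phi> ` A))" for r :: real
  have cK: "closed (K r)" for r
    unfolding K_def by (intro compact_imp_closed compact_scaling finite_imp_compact_convex_hull finite_imageI fA)
  have KV: "K r \<subseteq> V" for r
  proof -
    have "convex hull (\<phi> ` A) \<subseteq> V"
      by (rule hull_minimal) (use AR c(1) in \<open>auto simp: linear_on_def subspace_imp_convex V\<close>)
    then show ?thesis using V by (auto simp: K_def subspace_scale)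
  qed
  \<comment> \<open>The coordinates of \<open>y\<close> have sum norm at most \<open>C * r\<close>.
    After division they lie in the cross-polytope, and \<open>\<phi>\<close> preserves convex
    combinations.\<close>
  have VK: "y \<in> K (C * r)" if "y \<in> V" "norm y \<le> r" "r > 0" for y r
  proof -
    let ?z = "(1 / (C * r)) *\<^sub>R \<kappa> y"
    have z: "\<kappa> y \<in> Rn k" using c(2) that by (auto simp: linear_on_def)
    have "norm (\<kappa> y) \<le> C * r" using C(2)[OF that(1)] C(1) that(2)
      by (meson mult_left_mono less_imp_le order_trans)
    then have "?z \<in> convex hull A"
      unfolding A_def using C(1) that(3) z
      by (intro Rn_cball_subset_hull) (auto simp: subspace_scale subspace_Rn)
    then obtain S u where S: "finite S" "S \<subseteq> A" "\<forall>x\<in>S. 0 \<le> u x" "sum u S = 1" "(\<Sum>v\<in>S. u v *\<^sub>R v) = ?z"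
      by (auto simp: convex_hull_explicit)
    have SR: "v \<in> Rn k" if "v \<in> S" for v using S(2) AR that by auto
    have "\<phi> ?z = (\<Sum>v\<in>S. u v *\<^sub>R \<phi> v)"
      unfolding S(5)[symmetric]
      by (subst linear_on_sum[OF c(1) subspace_Rn])
        (auto intro: subspace_scale[OF subspace_Rn] SR simp: linear_on_scale[OF c(1) SR])
    also have "\<dots> \<in> convex hull (\<phi> ` A)"
      by (rule convex_sum) (use S in \<open>auto intro: hull_inc\<close>)
    finally have "\<phi> ?z \<in> convex hull (\<phi> ` A)" .
    moreover have "(C * r) *\<^sub>R \<phi> ?z = y"
      using C(1) that by (simp add: linear_on_scale[OF c(1) z] c(4))
    ultimately show ?thesis unfolding K_def by force
  qed
  show ?thesis
    unfolding closed_sequential_limits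
  proof (intro allI impI, elim conjE)
    fix x l assume x: "\<forall>n. x n \<in> V" "x \<longlonglongrightarrow> l"
    have "Bseq x" using x(2) convergent_def convergent_imp_Bseq by blast
    then obtain r where "r > 0" "\<And>n. norm (x n) \<le> r" by (auto simp: Bseq_def)
    then have "l \<in> K (C * r)"
      using closed_sequentially[OF cK _ x(2)] VK x(1) by blast
    then show "l \<in> V" using KV by auto
  qed
qed

lemma closure_of_subspace:
  fixes S :: "'a::real_normed_vector set"
  assumes "subspace S"
  shows "subspace (closure S)"
proof (rule subspaceI)
  show "0 \<in> closure S" using assms closure_subset subspace_0 by blast
  fix x assume "x \<in> closure S"
  then obtain s where s: "\<And>n. s n \<in> S" "s \<longlonglongrightarrow> x" by (auto simp: closure_sequential)
  show "c *\<^sub>R x \<in> closure S" for c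
    unfolding closure_sequential
    by (rule exI[of _ "\<lambda>n. c *\<^sub>R s n"]) (auto intro: s subspace_scale[OF assms] tendsto_intros)
  fix y assume "y \<in> closure S"
  then obtain r where r: "\<And>n. r n \<in> S" "r \<longlonglongrightarrow> y" by (auto simp: closure_sequential)
  show "x + y \<in> closure S"
    unfolding closure_sequential
    by (rule exI[of _ "\<lambda>n. s n + r n"]) (auto intro: s r subspace_add[OF assms] tendsto_add)
qed

text \<open>A 1-bounded operator is 1-Lipschitz, so it extends to the closure with values in a
  complete space. Linearity and the bound pass to limits of sequences, and closedness of
  \<open>W\<close> keeps the values there.\<close>

lemma one_bounded_extension:
  fixes S :: "'a::real_normed_vector set" and W :: "'b::banach set"
  assumes S: "subspace S" and f: "one_bounded S norm W norm f" and W: "closed W"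
  obtains T where "one_bounded (closure S) norm W norm T" "\<And>x. x \<in> S \<Longrightarrow> T x = f x"
proof -
  have lin: "linear_on S W f" and bd: "\<And>x. x \<in> S \<Longrightarrow> norm (f x) \<le> norm x"
    using f by (auto simp: one_bounded_def)
  have "1-lipschitz_on S f"
    by (rule lipschitz_onI) (simp_all add: dist_norm linear_on_diff[OF lin S, symmetric] bd subspace_diff S)
  then have "uniformly_continuous_on S f" by (rule lipschitz_on_uniformly_continuous)
  then obtain T where T: "uniformly_continuous_on (closure S) T" "\<And>x. x \<in> S \<Longrightarrow> f x = T x"
    by (rule uniformly_continuous_on_extension_on_closure) (rule that)
  have lim: "(\<lambda>n. f (s n)) \<longlonglongrightarrow> T x" if "\<And>n. s n \<in> S" "s \<longlonglongrightarrow> x" for s x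
  proof -
    have "x \<in> closure S" unfolding closure_sequential using that by blast
    then have "(\<lambda>n. T (s n)) \<longlonglongrightarrow> T x"
      using that closure_subset[of S]
      by (intro continuous_on_tendsto_compose[OF uniformly_continuous_imp_continuous[OF T(1)]]
          always_eventually) auto
    then show ?thesis using T(2) that by simp
  qed
  have "linear_on (closure S) W T"
  proof (rule linear_onI)
    fix x assume "x \<in> closure S"
    then obtain s where s: "\<And>n. s n \<in> S" "s \<longlonglongrightarrow> x" by (auto simp: closure_sequential)
    show "T x \<in> W"
      using closed_sequentially[OF W _ lim[OF s]] linear_on_mem[OF lin] s by blast
    show "T (c *\<^sub>R x) = c *\<^sub>R T x" for c
    proof -
      have "(\<lambda>n. f (c *\<^sub>R s n)) \<longlonglongrightarrow> T (c *\<^sub>R x)"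
        by (rule lim) (auto intro: s subspace_scale[OF S] tendsto_intros)
      moreover have "(\<lambda>n. f (c *\<^sub>R s n)) \<longlonglongrightarrow> c *\<^sub>R T x"
        using tendsto_scaleR[OF tendsto_const lim[OF s]] by (simp add: linear_on_scale[OF lin s(1)])
      ultimately show ?thesis by (rule LIMSEQ_unique)
    qed
    fix y assume "y \<in> closure S"
    then obtain r where r: "\<And>n. r n \<in> S" "r \<longlonglongrightarrow> y" by (auto simp: closure_sequential)
    have "(\<lambda>n. f (s n + r n)) \<longlonglongrightarrow> T (x + y)"
      by (rule lim) (auto intro: s r subspace_add[OF S] tendsto_add)
    moreover have "(\<lambda>n. f (s n + r n)) \<longlonglongrightarrow> T x + T y"
      using tendsto_add[OF lim[OF s] lim[OF r]] by (simp add: linear_on_add[OF lin s(1) r(1)])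
    ultimately show "T (x + y) = T x + T y" by (rule LIMSEQ_unique)
  qed
  moreover have "norm (T x) \<le> norm x" if x: "x \<in> closure S" for x
  proof -
    obtain s where s: "\<And>n. s n \<in> S" "s \<longlonglongrightarrow> x" using x by (auto simp: closure_sequential)
    show ?thesis
      by (rule LIMSEQ_le[OF tendsto_norm[OF lim[OF s]] tendsto_norm[OF s(2)]]) (use bd s in auto)
  qed
  ultimately show thesis using T(2) by (intro that[of T]) (auto simp: one_bounded_def)
qed

section \<open>Norms prescribed by their unit balls\<close>

text \<open>\<open>M\<close> is the Minkowski functional of \<open>B\<close>. Since \<open>B\<close>
  lies between the \<open>N\<close>-balls of radius \<open>r\<close> and 1, \<open>M\<close> is
  finite, definite and comparable with \<open>N\<close>; symmetry and convexity give the norm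
  axioms, and closedness makes \<open>B\<close> the exact unit ball.\<close>

lemma gauge_norm:
  fixes V B :: "'a::real_normed_vector set"
  assumes V: "subspace V" and N: "norm_on V N"
    and B: "convex B" "closed B" "B \<subseteq> V" "\<And>x. x \<in> B \<Longrightarrow> - x \<in> B" "\<And>x. x \<in> B \<Longrightarrow> N x \<le> 1"
    and r: "r > 0" "\<And>x. x \<in> V \<Longrightarrow> N x \<le> r \<Longrightarrow> x \<in> B"
  obtains M where "norm_on V M" "{x \<in> V. M x \<le> 1} = B"
    "\<And>x. x \<in> V \<Longrightarrow> N x \<le> M x" "\<And>x. x \<in> V \<Longrightarrow> M x \<le> N x / r"
proof -
  define A where "A x = {t. 0 < t \<and> (1 / t) *\<^sub>R x \<in> B}" for x
  define M where "M x = Inf (A x)" for x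
  have "0 \<in> B" using r(2)[of 0] r(1) norm_on_eq_0[OF N, of 0] V by (auto simp: subspace_0)
  have bdd: "bdd_below (A x)" for x by (rule bdd_belowI[of _ 0]) (auto simp: A_def)
  have inA: "t \<in> A x" if "x \<in> V" "t > 0" "N x / r \<le> t" for x t
  proof -
    have "N ((1 / t) *\<^sub>R x) = N x / t" using norm_on_scale[OF N that(1)] that by simp
    also have "\<dots> \<le> r" using that r(1) by (simp add: field_simps)
    finally show ?thesis using that V by (auto simp: A_def subspace_scale intro: r)
  qed
  have ne: "A x \<noteq> {}" if "x \<in> V" for x
    using inA[OF that, of "max 1 (N x / r)"] by (metis empty_iff less_max_iff_disj max.cobounded2 zero_less_one)
  have A_ge: "N x \<le> t" if "t \<in> A x" "x \<in> V" for x t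
    using B(5)[of "(1 / t) *\<^sub>R x"] that norm_on_scale[OF N that(2), of "1 / t"]
    by (auto simp: A_def field_simps)
  have NM: "N x \<le> M x" if "x \<in> V" for x
    unfolding M_def using ne[OF that] A_ge that by (intro cInf_greatest) auto
  have M_le: "M x \<le> t" if "t \<in> A x" for x t
    unfolding M_def using that bdd by (rule cInf_lower)
  \<comment> \<open>The set of admissible dilations is closed upwards because \<open>B\<close> is
    convex and contains 0.\<close>
  have upA: "s \<in> A x" if "t \<in> A x" "t \<le> s" for x s t
  proof -
    have t: "0 < t" "(1 / t) *\<^sub>R x \<in> B" using that by (auto simp: A_def)
    have "(t / s) *\<^sub>R (1 / t) *\<^sub>R x + (1 - t / s) *\<^sub>R 0 \<in> B"
      using t that \<open>0 \<in> B\<close> by (intro convexD[OF B(1)]) auto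
    then show ?thesis using t that by (simp add: A_def)
  qed
  have gtA: "t \<in> A x" if x: "x \<in> V" and t: "M x < t" for x t
  proof -
    obtain a where "a \<in> A x" "a < t"
      using cInf_lessD[OF ne[OF x], of t] t unfolding M_def by auto
    then show ?thesis using upA by force
  qed
  \<comment> \<open>Closedness of \<open>B\<close> is used here: \<open>t\<close> is approached from
    above by dilations already known to be admissible.\<close>
  have geA: "t \<in> A x" if x: "x \<in> V" and t: "M x \<le> t" "t > 0" for x t
  proof -
    have lim: "(\<lambda>n. (1 / (t + 1 / real (Suc n))) *\<^sub>R x) \<longlonglongrightarrow> (1 / (t + 0)) *\<^sub>R x"
      using t by (intro tendsto_intros LIMSEQ_Suc lim_1_over_n) auto
    have mem: "(1 / (t + 1 / real (Suc n))) *\<^sub>R x \<in> B" for n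
      using gtA[OF x, of "t + 1 / real (Suc n)"] t
        add_less_le_mono[of 0 "1 / real (Suc n)" "M x" t] by (auto simp: A_def)
    have "(1 / (t + 0)) *\<^sub>R x \<in> B"
      by (rule closed_sequentially[OF B(2) _ lim]) (rule mem)
    then show ?thesis using t by (simp add: A_def)
  qed
  have M_up: "M x \<le> N x / r" if "x \<in> V" for x
  proof (rule dense_ge)
    fix t assume "N x / r < t"
    then show "M x \<le> t"
      using norm_on_ge_0[OF N that] r(1)
      by (intro M_le inA that) (auto intro: le_less_trans[rotated])
  qed
  have M0: "M 0 = 0"
    using M_up[of 0] NM[of 0] norm_on_eq_0[OF N, of 0] V by (simp add: subspace_0)
  have M_nonneg: "0 \<le> M x" if "x \<in> V" for x
    using NM[OF that] norm_on_ge_0[OF N that] by linarith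
  have tri: "M (x + y) \<le> M x + M y" if "x \<in> V" "y \<in> V" for x y
  proof (rule field_le_epsilon)
    fix e :: real assume e: "e > 0"
    define s t where "s = M x + e / 2" and "t = M y + e / 2"
    have st: "s > 0" "t > 0" using M_nonneg[OF that(1)] M_nonneg[OF that(2)] e by (auto simp: s_def t_def)
    have "s \<in> A x" "t \<in> A y" using that e by (auto intro!: gtA simp: s_def t_def)
    \<comment> \<open>The sum of the dilates of \<open>B\<close> by \<open>s\<close> and
      \<open>t\<close> lies in the dilate by \<open>s + t\<close>: a convex combination with weights
      proportional to \<open>s\<close> and \<open>t\<close>.\<close>
    then have "(s / (s + t)) *\<^sub>R (1 / s) *\<^sub>R x + (t / (s + t)) *\<^sub>R (1 / t) *\<^sub>R y \<in> B"
      using st by (intro convexD[OF B(1)]) (auto simp: A_def add_divide_distrib[symmetric])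
    then have "s + t \<in> A (x + y)" using st by (simp add: A_def scaleR_add_right)
    from M_le[OF this] show "M (x + y) \<le> M x + M y + e" by (simp add: s_def t_def)
  qed
  have A_neg: "A (- x) = A x" for x
    using B(4)[of "(1 / t) *\<^sub>R x" for t] B(4)[of "- ((1 / t) *\<^sub>R x)" for t] by (auto simp: A_def)
  have A_pos: "c * t \<in> A (c *\<^sub>R x)" if "c > 0" "t \<in> A x" for c t x
    using that by (auto simp: A_def)
  have sc1: "M (c *\<^sub>R x) \<le> c * M x" if "c > 0" "x \<in> V" for c x
  proof -
    have "M (c *\<^sub>R x) / c \<le> M x"
    proof (rule dense_ge)
      fix t assume "M x < t"
      then have "M (c *\<^sub>R x) \<le> c * t" using gtA[OF that(2)] A_pos[OF that(1)] M_le by blast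
      then show "M (c *\<^sub>R x) / c \<le> t" using that by (simp add: field_simps)
    qed
    then show ?thesis using that by (simp add: field_simps)
  qed
  have sc: "M (c *\<^sub>R x) = c * M x" if "c > 0" "x \<in> V" for c x
    using sc1[OF that] sc1[of "1 / c" "c *\<^sub>R x"] that V by (simp add: subspace_scale field_simps)
  have scale: "M (c *\<^sub>R x) = \<bar>c\<bar> * M x" if "x \<in> V" for c x
  proof (cases "c = 0")
    case False
    have "M (c *\<^sub>R x) = M (\<bar>c\<bar> *\<^sub>R x)"
      using A_neg[of "c *\<^sub>R x"] by (auto simp: M_def abs_if)
    then show ?thesis using sc[of "\<bar>c\<bar>" x] that False by simp
  qed (simp add: M0)
  have "norm_on V M"
    unfolding norm_on_def
  proof (intro conjI ballI allI)
    show "M x = 0 \<longleftrightarrow> x = 0" if "x \<in> V" for x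
      using NM[OF that] norm_on_ge_0[OF N that] norm_on_eq_0[OF N that] M0 by fastforce
  qed (auto intro: M_nonneg tri scale)
  moreover have "{x \<in> V. M x \<le> 1} = B"
  proof (intro equalityI subsetI)
    fix x assume "x \<in> {x \<in> V. M x \<le> 1}"
    then show "x \<in> B" using geA[of x 1] by (simp add: A_def)
  next
    fix x assume "x \<in> B"
    then show "x \<in> {x \<in> V. M x \<le> 1}" using M_le[of 1 x] B(3) by (auto simp: A_def)
  qed
  ultimately show thesis using that NM M_up by blast
qed

section \<open>Rational polyhedral norms\<close>

lemma Qn_subset_Rn: "Qn n \<subseteq> Rn n"
  by (auto simp: Qn_def)

lemma Qn_mono: "m \<le> n \<Longrightarrow> Qn m \<subseteq> Qn n"
  using Rn_mono by (auto simp: Qn_def)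

lemma convex_norm_on_ball:
  assumes "norm_on V N" "subspace V"
  shows "convex {x \<in> V. N x \<le> r}"
proof (rule convexI)
  fix x y u v assume *: "x \<in> {x \<in> V. N x \<le> r}" "y \<in> {x \<in> V. N x \<le> r}" "0 \<le> u" "0 \<le> v" "u + v = (1::real)"
  then have "u *\<^sub>R x + v *\<^sub>R y \<in> V" using assms(2) by (simp add: subspace_add subspace_scale)
  moreover have "N (u *\<^sub>R x + v *\<^sub>R y) \<le> N (u *\<^sub>R x) + N (v *\<^sub>R y)"
    using * assms by (intro norm_on_triangle) (auto simp: subspace_scale)
  moreover have "N (u *\<^sub>R x) + N (v *\<^sub>R y) = u * N x + v * N y"
    using * by (simp add: norm_on_scale[OF assms(1)])
  moreover have "u * N x + v * N y \<le> r"
    using * by (intro convex_bound_le) auto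
  ultimately show "u *\<^sub>R x + v *\<^sub>R y \<in> {x \<in> V. N x \<le> r}" by auto
qed

text \<open>A point \<open>x\<close> of the ball of radius \<open>1 - \<eta>\<close> is rounded down to a point \<open>q\<close> of the
  grid of mesh \<open>1/M\<close>; then \<open>x\<close> is the barycentre of points on the segments from \<open>q\<close> to the grid
  points \<open>q + (n/M) e\<^sub>i\<close>, all of which remain in the unit ball.\<close>

lemma rational_polytope_approx:
  assumes N: "norm_on (Rn n) N" and \<eta>: "0 < \<eta>"
  obtains A where "finite A" "A \<subseteq> Qn n" "\<And>a. a \<in> A \<Longrightarrow> - a \<in> A" "\<And>a. a \<in> A \<Longrightarrow> N a \<le> 1"
    "\<And>x. x \<in> Rn n \<Longrightarrow> N x \<le> 1 - \<eta> \<Longrightarrow> x \<in> convex hull A"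
proof -
  obtain C1 where C1: "C1 > 0" "\<And>x. x \<in> Rn n \<Longrightarrow> N x \<le> C1 * norm x"
    using norm_on_le_norm[OF N] by blast
  obtain C2 where C2: "C2 > 0" "\<And>x. x \<in> Rn n \<Longrightarrow> norm x \<le> C2 * N x"
    using norm_le_norm_on[OF N] by blast
  \<comment> \<open>The quantity \<open>C1 * (n / M)\<close> bounds both the rounding error and the
    step from \<open>q\<close> to a neighbour \<open>p i\<close>. Making it at most half of \<eta>
    keeps all these points in the unit ball.\<close>
  obtain M :: nat where M0: "2 * C1 * n / \<eta> + 1 < real M" using reals_Archimedean2 by blast
  have "0 \<le> 2 * C1 * n / \<eta>" using C1 \<eta> by simp
  then have M: "real M > 0" using M0 by linarith
  have "2 * C1 * n / \<eta> \<le> real M" using M0 by linarith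
  then have Mn: "2 * (C1 * (n / M)) \<le> \<eta>" using \<eta> M by (simp add: field_simps)
  define A where "A = {q \<in> Rn n. (\<forall>i. real M * Poly_Mapping.lookup q i \<in> \<int>) \<and> N q \<le> 1}"
  show thesis
  proof (rule that)
    \<comment> \<open>The possible coordinates of points of \<open>A\<close>: multiples of
      \<open>1 / M\<close> of absolute value at most \<open>C2\<close>. This makes \<open>A\<close>
      finite.\<close>
    define R where "R = (\<lambda>z::int. real_of_int z / M) ` {-\<lfloor>M * C2\<rfloor>..\<lfloor>M * C2\<rfloor>}"
    have "A \<subseteq> (\<lambda>f. \<Sum>k<n. f k *\<^sub>R Poly_Mapping.single k 1) ` (PiE {..<n} (\<lambda>_. R))"
    proof
      fix q assume q: "q \<in> A"
      then have qR: "q \<in> Rn n" by (simp add: A_def)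
      have "Poly_Mapping.lookup q i \<in> R" for i
      proof -
        obtain z where z: "real M * Poly_Mapping.lookup q i = of_int z"
          using q by (auto simp: A_def elim: Ints_cases)
        have "norm q \<le> C2 * N q" by (rule C2(2)[OF qR])
        also have "\<dots> \<le> C2 * 1" using q C2(1) by (intro mult_left_mono) (auto simp: A_def)
        finally have "\<bar>Poly_Mapping.lookup q i\<bar> \<le> C2" using abs_lookup_le_norm[of q i] by simp
        then have "\<bar>real M * Poly_Mapping.lookup q i\<bar> \<le> M * C2" using M by (simp add: abs_mult)
        then have "\<bar>real_of_int z\<bar> \<le> M * C2" using z by simp
        then have "z \<in> {-\<lfloor>M * C2\<rfloor>..\<lfloor>M * C2\<rfloor>}"
          using le_floor_iff[of z "M * C2"] le_floor_iff[of "- z" "M * C2"] by auto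
        moreover have "Poly_Mapping.lookup q i = of_int z / M" using z M by (simp add: field_simps)
        ultimately show ?thesis unfolding R_def by blast
      qed
      then have "restrict (Poly_Mapping.lookup q) {..<n} \<in> PiE {..<n} (\<lambda>_. R)" by simp
      moreover have "q = (\<Sum>k<n. restrict (Poly_Mapping.lookup q) {..<n} k *\<^sub>R Poly_Mapping.single k 1)"
        using Rn_expansion[OF qR] by simp
      ultimately show "q \<in> (\<lambda>f. \<Sum>k<n. f k *\<^sub>R Poly_Mapping.single k 1) ` (PiE {..<n} (\<lambda>_. R))"
        by blast
    qed
    then show "finite A" by (rule finite_subset) (auto intro!: finite_imageI finite_PiE simp: R_def)
    show "A \<subseteq> Qn n"
    proof
      fix q assume q: "q \<in> A"
      have "Poly_Mapping.lookup q i \<in> \<rat>" for i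
      proof -
        have "real M * Poly_Mapping.lookup q i \<in> \<rat>" using q Ints_subset_Rats by (auto simp: A_def)
        then have "(real M * Poly_Mapping.lookup q i) / real M \<in> \<rat>" by (intro Rats_divide) auto
        then show ?thesis using M by simp
      qed
      then show "q \<in> Qn n" using q by (simp add: A_def Qn_def)
    qed
    show "- a \<in> A" if "a \<in> A" for a
      using that norm_on_scale[OF N, of a "-1"] by (auto simp: A_def subspace_neg subspace_Rn)
    show "N a \<le> 1" if "a \<in> A" for a using that by (simp add: A_def)
    fix x assume x: "x \<in> Rn n" and Nx: "N x \<le> 1 - \<eta>"
    have \<eta>1: "\<eta> \<le> 1" using norm_on_ge_0[OF N x] Nx by simp
    show "x \<in> convex hull A"
    proof (cases "n = 0")
      case True
      then have "x = 0" using Rn_expansion[OF x] by simp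
      moreover have "0 \<in> A"
        using subspace_0[OF subspace_Rn] norm_on_eq_0[OF N, of 0] by (auto simp: A_def)
      ultimately show ?thesis by (simp add: hull_inc)
    next
      case False
      define c where "c i = of_int \<lfloor>M * Poly_Mapping.lookup x i\<rfloor> / real M" for i
      define t where "t i = Poly_Mapping.lookup x i - c i" for i
      define q where "q = (\<Sum>k<n. c k *\<^sub>R Poly_Mapping.single k (1::real))"
      \<comment> \<open>The offset \<open>n / M\<close> is \<open>n\<close> times the largest
        possible remainder, so \<open>y i\<close> lies between \<open>q\<close> and
        \<open>p i\<close>. The factor \<open>n\<close> in \<open>y i\<close> is cancelled by the
        weights \<open>1 / n\<close> of the average, which is therefore \<open>x\<close>.\<close>
      define p where "p i = q + (n / M) *\<^sub>R Poly_Mapping.single i 1" for i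
      define y where "y i = q + (n * t i) *\<^sub>R Poly_Mapping.single i 1" for i
      have qR: "q \<in> Rn n" unfolding q_def by (rule lincomb_in_Rn)
      have Mt: "M * t i = M * Poly_Mapping.lookup x i - of_int \<lfloor>M * Poly_Mapping.lookup x i\<rfloor>" for i
        using M by (simp add: t_def c_def algebra_simps)
      have t01: "0 \<le> M * t i" "M * t i \<le> 1" for i
        unfolding Mt by linarith+
      have t0: "0 \<le> t i" and t1: "t i \<le> 1 / M" for i
        using t01[of i] M by (auto simp: field_simps zero_le_mult_iff)
      have "norm (q - x) = (\<Sum>k<n. \<bar>t k\<bar>)"
        using norm_Rn[OF subspace_diff[OF subspace_Rn qR x]]
        by (simp add: lookup_minus q_def lookup_lincomb t_def abs_minus_commute)
      also have "\<dots> \<le> (\<Sum>k<n. 1 / M)" by (rule sum_mono) (use t0 t1 in auto)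
      finally have nqx: "norm (q - x) \<le> n / M" by simp
      have "N q \<le> N (q - x) + N x"
        using norm_on_triangle[OF N subspace_diff[OF subspace_Rn qR x] x] by simp
      also have "N (q - x) \<le> C1 * norm (q - x)" by (intro C1 subspace_diff subspace_Rn qR x)
      also have "\<dots> \<le> C1 * (n / M)" using nqx C1(1) by (intro mult_left_mono) auto
      finally have Nq: "N q \<le> 1 - \<eta> + C1 * (n / M)" using Nx by simp
      have C1p: "0 \<le> C1 * (n / M)" using C1(1) by simp
      have intq: "real M * Poly_Mapping.lookup q i \<in> \<int>" for i
        using M by (auto simp: q_def lookup_lincomb c_def)
      have qA: "q \<in> A" using Nq Mn C1p qR intq by (simp add: A_def)
      have pA: "p i \<in> A" if i: "i < n" for i
      proof -
        have e: "(n / M) *\<^sub>R Poly_Mapping.single i 1 \<in> Rn n"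
          using i by (intro subspace_scale subspace_Rn single_in_Rn)
        have "N (p i) \<le> N q + N ((n / M) *\<^sub>R Poly_Mapping.single i 1)"
          unfolding p_def by (intro norm_on_triangle[OF N] qR e)
        also have "N ((n / M) *\<^sub>R Poly_Mapping.single i 1) \<le> C1 * (n / M)"
          using C1(2)[OF e] by simp
        finally have "N (p i) \<le> 1" using Nq Mn by simp
        moreover have "real M * Poly_Mapping.lookup (p i) l \<in> \<int>" for l
          using intq[of l] M by (auto simp: p_def lookup_add lookup_single when_def distrib_left)
        moreover have "p i \<in> Rn n" unfolding p_def by (intro subspace_add subspace_Rn qR e)
        ultimately show ?thesis by (simp add: A_def)
      qed
      have yA: "y i \<in> convex hull A" if i: "i < n" for i
      proof -
        have "(1 - M * t i) *\<^sub>R q + (M * t i) *\<^sub>R p i \<in> convex hull A"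
          using t01[of i] qA pA[OF i] by (intro convexD convex_convex_hull) (auto intro: hull_inc)
        also have "(1 - M * t i) *\<^sub>R q + (M * t i) *\<^sub>R p i = y i"
          using M by (simp add: p_def y_def scaleR_add_right scaleR_diff_left)
        finally show ?thesis .
      qed
      have "(\<Sum>i<n. (1 / n) *\<^sub>R y i) \<in> convex hull A"
        using yA False by (intro convex_sum convex_convex_hull) auto
      also have "(\<Sum>i<n. (1 / n) *\<^sub>R y i) = (\<Sum>i<n. (1 / n) *\<^sub>R q) + (\<Sum>i<n. t i *\<^sub>R Poly_Mapping.single i 1)"
        using False by (simp add: y_def scaleR_add_right sum.distrib)
      also have "(\<Sum>i<n. (1 / n) *\<^sub>R q) = q" using False by (simp add: sum_constant_scaleR del: sum_constant)
      also have "(\<Sum>i<n. t i *\<^sub>R Poly_Mapping.single i 1) = x - q"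
        using Rn_expansion[OF x] by (simp add: t_def scaleR_diff_left sum_subtractf q_def)
      finally show ?thesis by simp
    qed
  qed
qed

section \<open>Enlarging a rational space isometrically\<close>

definition trunc :: "nat \<Rightarrow> fvec \<Rightarrow> fvec" where
  "trunc n z = (\<Sum>k<n. Poly_Mapping.lookup z k *\<^sub>R Poly_Mapping.single k 1)"

lemma lookup_trunc: "Poly_Mapping.lookup (trunc n z) k = (if k < n then Poly_Mapping.lookup z k else 0)"
  by (simp add: trunc_def lookup_lincomb)

lemma trunc_in_Rn: "trunc n z \<in> Rn n"
  unfolding trunc_def by (rule lincomb_in_Rn)

lemma trunc_Rn: "z \<in> Rn n \<Longrightarrow> trunc n z = z"
  unfolding trunc_def by (rule Rn_expansion)

lemma linear_trunc: "linear (trunc n)"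
  by (rule linearI) (auto intro!: poly_mapping_eqI simp: lookup_trunc lookup_add)

text \<open>The ball of \<open>Y\<close> is the hull of the vertices of \<open>U\<close> and a
  rational polytope close to the ball of \<open>N\<close>. The vertices of \<open>U\<close> give
  \<open>rnorm Y \<le> rnorm U\<close> on \<open>U\<close>, and \<open>UN\<close> gives the
  converse, so the inclusion is isometric exactly although \<open>N\<close> is only approximated.
  \<open>UN\<close> also makes truncation 1-bounded.\<close>

lemma rational_extension:
  assumes U: "rational_space U"
    and N: "norm_on (Rn (rdim U + k)) N"
    and NU: "\<And>w. w \<in> carr U \<Longrightarrow> N w \<le> rnorm U w"
    and UN: "\<And>z. z \<in> Rn (rdim U + k) \<Longrightarrow> rnorm U (trunc (rdim U) z) \<le> N z"
    and \<eta>: "0 < \<eta>" "\<eta> < 1"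
  obtains Y where "rational_space Y" "rdim Y = rdim U + k" "F_arrow U Y (id, trunc (rdim U))"
    "\<And>z. z \<in> carr Y \<Longrightarrow> N z \<le> rnorm Y z" "\<And>z. z \<in> carr Y \<Longrightarrow> rnorm Y z \<le> N z / (1 - \<eta>)"
proof -
  define d where "d = rdim U"
  define V where "V = Rn (d + k)"
  have V: "subspace V" unfolding V_def by (rule subspace_Rn)
  have NV: "norm_on V N" using N by (simp add: V_def d_def)
  have nU: "norm_on (Rn d) (rnorm U)" using U by (simp add: rational_space_def d_def)
  have dV: "Rn d \<subseteq> V" unfolding V_def by (rule Rn_mono) simp
  obtain A where A: "finite A" "A \<subseteq> Qn (d + k)" "\<And>a. a \<in> A \<Longrightarrow> - a \<in> A"
    "\<And>a. a \<in> A \<Longrightarrow> N a \<le> 1" "\<And>x. x \<in> V \<Longrightarrow> N x \<le> 1 - \<eta> \<Longrightarrow> x \<in> convex hull A"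
    using rational_polytope_approx[OF NV[unfolded V_def] \<eta>(1)] unfolding V_def by metis
  obtain AU where AU: "finite AU" "AU \<subseteq> Qn d" "{x \<in> Rn d. rnorm U x \<le> 1} = convex hull AU"
    using U by (auto simp: rational_space_def d_def)
  have AUd: "a \<in> Rn d" "rnorm U a \<le> 1" if "a \<in> AU" for a
    using AU(3) hull_inc[OF that, of convex] by auto
  define B where "B = convex hull (A \<union> AU)"
  have UB: "convex hull AU \<subseteq> B" and AB: "convex hull A \<subseteq> B"
    unfolding B_def by (intro hull_mono; simp)+
  have AV: "A \<subseteq> V" using A(2) Qn_subset_Rn by (auto simp: V_def)
  \<comment> \<open>By \<open>NU\<close> the vertices of \<open>U\<close> lie in the unit ball of
    \<open>N\<close>; hence the new norm dominates \<open>N\<close>.\<close>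
  have ball: "B \<subseteq> {x \<in> V. N x \<le> 1}"
    unfolding B_def
  proof (rule hull_minimal)
    show "A \<union> AU \<subseteq> {x \<in> V. N x \<le> 1}"
      using AV A(4) AUd dV NU unfolding d_def by (force intro: order_trans)
  qed (rule convex_norm_on_ball[OF NV V])
  have neg: "- x \<in> B" if "x \<in> B" for x
  proof -
    have "B \<subseteq> uminus -` B"
      unfolding B_def
    proof (rule hull_minimal)
      show "convex (uminus -` (convex hull (A \<union> AU)))"
        by (intro convex_linear_vimage convex_convex_hull) (simp add: linear_iff)
      have "- a \<in> convex hull AU" if "a \<in> AU" for a
        unfolding AU(3)[symmetric]
        using AUd[OF that] norm_on_scale[OF nU, of a "-1"] by (simp add: subspace_neg subspace_Rn)
      then show "A \<union> AU \<subseteq> uminus -` (convex hull (A \<union> AU))"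
        using A(3) UB unfolding B_def by (auto intro: hull_inc)
    qed
    then show ?thesis using that by auto
  qed
  obtain M where M: "norm_on V M" "{x \<in> V. M x \<le> 1} = B"
    "\<And>x. x \<in> V \<Longrightarrow> N x \<le> M x" "\<And>x. x \<in> V \<Longrightarrow> M x \<le> N x / (1 - \<eta>)"
  \<comment> \<open>The inner radius is \<open>1 - \<eta>\<close> because the hull of
    \<open>A\<close> already contains that ball; this is the source of the factor in the upper
    estimate for \<open>rnorm Y\<close>.\<close>
  proof (rule gauge_norm[OF V NV, of B "1 - \<eta>"])
    show "convex B" unfolding B_def by (rule convex_convex_hull)
    show "closed B" unfolding B_def
      using A(1) AU(1) by (intro compact_imp_closed finite_imp_compact_convex_hull) simp
  qed (use ball neg \<eta> A(5) AB in \<open>auto\<close>)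
  have MU: "M w = rnorm U w" if w: "w \<in> Rn d" for w
  proof (rule antisym)
    have "rnorm U w \<le> N w" using UN[of w] w dV trunc_Rn[OF w] by (auto simp: V_def d_def)
    then show "rnorm U w \<le> M w" using M(3)[of w] w dV by force
    show "M w \<le> rnorm U w"
    proof (cases "w = 0")
      case True
      then show ?thesis
        using norm_on_eq_0[OF M(1), of 0] norm_on_eq_0[OF nU, of 0] V by (simp add: subspace_0 subspace_Rn)
    next
      case False
      define s where "s = rnorm U w"
      have s: "s > 0" using False norm_on_eq_0[OF nU w] norm_on_ge_0[OF nU w] by (simp add: s_def)
      then have "rnorm U ((1 / s) *\<^sub>R w) = 1"
        using norm_on_scale[OF nU w, of "1 / s"] by (simp add: s_def)
      then have "(1 / s) *\<^sub>R w \<in> B" using AU(3) w UB by (auto simp: subspace_scale subspace_Rn)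
      then have "M ((1 / s) *\<^sub>R w) \<le> 1" using M(2) by auto
      then have "M w / s \<le> 1" using s norm_on_scale[OF M(1), of w "1 / s"] w dV by auto
      then show ?thesis using s by (simp add: s_def field_simps)
    qed
  qed
  define Y where "Y = \<lparr>rdim = d + k, rnorm = M\<rparr>"
  show thesis
  proof (rule that[of Y])
    have "A \<union> AU \<subseteq> Qn (d + k)" using A(2) AU(2) Qn_mono[of d "d + k"] by auto
    then show "rational_space Y"
      using M(1,2) A(1) AU(1) unfolding rational_space_def Y_def B_def V_def
      by (auto intro!: exI[of _ "A \<union> AU"])
    have lid: "linear_on (Rn d) V id"
      using dV by (auto simp: linear_on_def)
    have ltr: "linear_on V (Rn d) (trunc d)"
      by (rule linear_imp_linear_on[OF linear_trunc]) (auto simp: trunc_in_Rn)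
    have "trunc d ` Qn (d + k) \<subseteq> Qn d"
      by (auto simp: Qn_def trunc_in_Rn lookup_trunc)
    moreover have "rnorm U (trunc d z) \<le> M z" if "z \<in> V" for z
      using UN[of z] M(3)[OF that] that by (simp add: V_def d_def)
    ultimately show "F_arrow U Y (id, trunc (rdim U))"
      using lid ltr MU Qn_mono[of d "d + k"]
      by (auto simp: F_arrow_def rational_operator_def one_bounded_def isometric_embedding_def
          Y_def V_def[symmetric] d_def[symmetric] trunc_Rn)
  qed (use M in \<open>auto simp: Y_def V_def d_def\<close>)
qed

section \<open>The chain and its completion\<close>

lemma fin_dim_subspace_image:
  assumes "fin_dim_subspace V" "linear_on V W f"
  shows "fin_dim_subspace (f ` V)"
proof -
  obtain B where V: "subspace V" and B: "finite B" "span B = V"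
    using assms(1) by (auto simp: fin_dim_subspace_def)
  have BV: "B \<subseteq> V" using B(2) span_superset by blast
  have sub: "subspace (f ` V)" by (rule subspace_image_linear_on[OF assms(2) V])
  have "f x \<in> span (f ` B)" if x: "x \<in> V" for x
  proof -
    obtain c where c: "x = (\<Sum>b\<in>B. c b *\<^sub>R b)"
      using x unfolding B(2)[symmetric] span_finite[OF B(1)] by auto
    have "f x = (\<Sum>b\<in>B. f (c b *\<^sub>R b))"
      unfolding c using BV V by (intro linear_on_sum[OF assms(2)]) (auto simp: subspace_scale)
    also have "\<dots> = (\<Sum>b\<in>B. c b *\<^sub>R f b)"
      using BV by (intro sum.cong refl linear_on_scale[OF assms(2)]) auto
    also have "\<dots> \<in> span (f ` B)"
      by (intro span_sum span_scale span_base imageI)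
    finally show ?thesis .
  qed
  moreover have "span (f ` B) \<subseteq> f ` V"
    by (rule span_minimal[OF _ sub]) (use BV in auto)
  ultimately have "span (f ` B) = f ` V" by auto
  then show ?thesis using B(1) sub unfolding fin_dim_subspace_def by (meson finite_imageI)
qed

lemma F_arrow_linear:
  assumes "F_arrow E F a"
  shows "linear_on (carr E) (carr F) (fst a)" "linear_on (carr F) (carr E) (snd a)"
  using assms by (auto simp: F_arrow_def one_bounded_def)

lemma F_arrow_norm:
  assumes "F_arrow E F a"
  shows "x \<in> carr E \<Longrightarrow> rnorm F (fst a x) = rnorm E x" "y \<in> carr F \<Longrightarrow> rnorm E (snd a y) \<le> rnorm F y"
  using assms by (auto simp: F_arrow_def one_bounded_def isometric_embedding_def)

lemma F_arrow_retract: "F_arrow E F a \<Longrightarrow> x \<in> carr E \<Longrightarrow> snd a (fst a x) = x"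
  by (auto simp: F_arrow_def)

lemma F_sequence_arrow: "F_sequence U u \<Longrightarrow> n \<le> m \<Longrightarrow> F_arrow (U n) (U m) (u n m)"
  by (auto simp: F_sequence_def)

lemma chain_embedding:
  assumes "chain_completion U u j P"
  shows "linear_on (carr (U n)) P (j n)"
    and "x \<in> carr (U n) \<Longrightarrow> norm (j n x) = rnorm (U n) x"
    and "n \<le> m \<Longrightarrow> x \<in> carr (U n) \<Longrightarrow> j m (fst (u n m) x) = j n x"
  using assms by (auto simp: chain_completion_def isometric_embedding_def)

lemma chain_embedding_inj:
  assumes "F_sequence U u" "chain_completion U u j P"
    and "x \<in> carr (U n)" "y \<in> carr (U n)" "j n x = j n y"
  shows "x = y"
proof -
  have "norm_on (carr (U n)) (rnorm (U n))"
    using assms(1) by (auto simp: F_sequence_def rational_space_def)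
  moreover have d: "x - y \<in> carr (U n)" using assms(3,4) by (intro subspace_diff subspace_Rn)
  moreover have "rnorm (U n) (x - y) = 0"
    using chain_embedding(2)[OF assms(2) d] linear_on_diff[OF chain_embedding(1)[OF assms(2)] subspace_Rn assms(3,4)]
      assms(5) by simp
  ultimately show ?thesis using norm_on_eq_0 by fastforce
qed

text \<open>The images increase along the chain, by compatibility with the bonding maps. Finitely
  many points of the union can thus be moved to a common stage.\<close>

lemma chain_union_eventually:
  assumes "F_sequence U u" "chain_completion U u j P" "y \<in> (\<Union>n. j n ` carr (U n))"
  obtains l where "\<And>m. l \<le> m \<Longrightarrow> y \<in> j m ` carr (U m)"
proof -
  obtain n x where x: "x \<in> carr (U n)" "y = j n x" using assms(3) by auto
  have "y \<in> j m ` carr (U m)" if "n \<le> m" for m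
    using chain_embedding(3)[OF assms(2) that x(1)]
      linear_on_mem[OF F_arrow_linear(1)[OF F_sequence_arrow[OF assms(1) that]] x(1)] x(2)
    by (metis imageI)
  then show thesis by (rule that)
qed

lemma chain_union_subspace:
  assumes "F_sequence U u" "chain_completion U u j P"
  shows "subspace (\<Union>n. j n ` carr (U n))"
proof (rule subspaceI)
  have sub: "subspace (j n ` carr (U n))" for n
    by (rule subspace_image_linear_on[OF chain_embedding(1)[OF assms(2)] subspace_Rn])
  show "0 \<in> (\<Union>n. j n ` carr (U n))" using subspace_0[OF sub[of 0]] by blast
  fix x assume x: "x \<in> (\<Union>n. j n ` carr (U n))"
  then obtain n where n: "x \<in> j n ` carr (U n)" by blast
  show "c *\<^sub>R x \<in> (\<Union>n. j n ` carr (U n))" for c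
    using subspace_scale[OF sub n, of c] by blast
  fix y assume y: "y \<in> (\<Union>n. j n ` carr (U n))"
  obtain l where l: "\<And>m. l \<le> m \<Longrightarrow> x \<in> j m ` carr (U m)"
    using chain_union_eventually[OF assms x] by blast
  obtain l' where l': "\<And>m. l' \<le> m \<Longrightarrow> y \<in> j m ` carr (U m)"
    using chain_union_eventually[OF assms y] by blast
  have "x + y \<in> j (max l l') ` carr (U (max l l'))"
    by (rule subspace_add[OF sub l l']) auto
  then show "x + y \<in> (\<Union>n. j n ` carr (U n))" by blast
qed

text \<open>On each stage \<open>l\<close> beyond \<open>m\<close> the operator is \<open>h\<close>
  after the projection \<open>snd (u m l)\<close>. Functoriality makes these agree on the union, and
  the common bound 1 allows extension to the completion.\<close>

lemma chain_projection:
  fixes j :: "nat \<Rightarrow> fvec \<Rightarrow> 'p::banach" and W :: "'w::banach set"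
  assumes seq: "F_sequence U u" and comp: "chain_completion U u j P"
    and h: "one_bounded (carr (U m)) (rnorm (U m)) W norm h" and W: "closed W"
  obtains T where "one_bounded P norm W norm T" "\<And>x. x \<in> carr (U m) \<Longrightarrow> T (j m x) = h x"
proof -
  define S where "S = (\<Union>n. j n ` carr (U n))"
  have P: "P = closure S" using comp by (simp add: chain_completion_def S_def)
  note emb = chain_embedding[OF comp]
  note arr = F_sequence_arrow[OF seq]
  have hl: "linear_on (carr (U m)) W h" and hb: "\<And>x. x \<in> carr (U m) \<Longrightarrow> norm (h x) \<le> rnorm (U m) x"
    using h by (auto simp: one_bounded_def)
  \<comment> \<open>Independence of the stage: \<open>x'\<close> is the bonding image of
    \<open>x\<close>, and the projection from \<open>l'\<close> to \<open>m\<close> factors through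
    \<open>l\<close>, where it returns \<open>x\<close>.\<close>
  have key: "snd (u m l) x = snd (u m l') x'"
    if "m \<le> l" "l \<le> l'" "x \<in> carr (U l)" "x' \<in> carr (U l')" "j l x = j l' x'" for l l' x x'
  proof -
    have fx: "fst (u l l') x \<in> carr (U l')"
      by (rule linear_on_mem[OF F_arrow_linear(1)[OF arr[OF that(2)]] that(3)])
    have "x' = fst (u l l') x"
      using chain_embedding_inj[OF seq comp that(4) fx] emb(3)[OF that(2,3)] that(5) by simp
    then have "snd (u l l') x' = x" using F_arrow_retract[OF arr[OF that(2)] that(3)] by simp
    moreover have "F_eq (U m) (U l') (F_comp (u l l') (u m l)) (u m l')"
      using seq that(1,2) by (auto simp: F_sequence_def)
    then have "snd (u m l) (snd (u l l') x') = snd (u m l') x'"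
      using that(4) by (auto simp: F_eq_def F_comp_def)
    ultimately show ?thesis by simp
  qed
  define T0 where "T0 y = (SOME v. \<exists>l x. m \<le> l \<and> x \<in> carr (U l) \<and> y = j l x \<and> v = h (snd (u m l) x))" for y
  have T0: "T0 (j l x) = h (snd (u m l) x)" if "m \<le> l" "x \<in> carr (U l)" for l x
    unfolding T0_def
  proof (rule some_equality)
    fix v assume "\<exists>l' x'. m \<le> l' \<and> x' \<in> carr (U l') \<and> j l x = j l' x' \<and> v = h (snd (u m l') x')"
    then obtain l' x' where *: "m \<le> l'" "x' \<in> carr (U l')" "j l x = j l' x'" "v = h (snd (u m l') x')"
      by blast
    then show "v = h (snd (u m l) x)"
      using key[OF that(1) _ that(2) *(2,3)] key[OF *(1) _ *(2) that(2)] by (metis nle_le)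
  qed (use that in blast)
  have rep: "\<exists>l\<ge>m. x \<in> j l ` carr (U l) \<and> y \<in> j l ` carr (U l)" if xy: "x \<in> S" "y \<in> S" for x y
  proof -
    obtain l where l: "\<And>m. l \<le> m \<Longrightarrow> x \<in> j m ` carr (U m)"
      using chain_union_eventually[OF seq comp] xy unfolding S_def by blast
    obtain l' where l': "\<And>m. l' \<le> m \<Longrightarrow> y \<in> j m ` carr (U m)"
      using chain_union_eventually[OF seq comp] xy unfolding S_def by blast
    show ?thesis
      by (rule exI[of _ "max m (max l l')"]) (use l l' in simp)
  qed
  have sub: "subspace S" unfolding S_def by (rule chain_union_subspace[OF seq comp])
  have "one_bounded S norm W norm T0"
    unfolding one_bounded_def
  proof (intro conjI ballI linear_onI)
    fix x assume x: "x \<in> S"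
    obtain l a where a: "m \<le> l" "a \<in> carr (U l)" "x = j l a" using rep[OF x x] by blast
    note sl = F_arrow_linear(2)[OF arr[OF a(1)]]
    show "T0 x \<in> W" using T0[OF a(1,2)] a(3) linear_on_mem[OF hl linear_on_mem[OF sl a(2)]] by simp
    show "norm (T0 x) \<le> norm x"
      using T0[OF a(1,2)] a hb[OF linear_on_mem[OF sl a(2)]] F_arrow_norm(2)[OF arr[OF a(1)] a(2)]
        emb(2)[OF a(2)] by simp
    show "T0 (c *\<^sub>R x) = c *\<^sub>R T0 x" for c
      using T0[OF a(1,2)] T0[OF a(1), of "c *\<^sub>R a"] a
      by (simp add: linear_on_scale[OF emb(1)] subspace_scale subspace_Rn linear_on_scale[OF sl]
          linear_on_scale[OF hl linear_on_mem[OF sl]])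
  next
    fix x y assume xy: "x \<in> S" "y \<in> S"
    obtain l a b where a: "m \<le> l" "a \<in> carr (U l)" "x = j l a" and b: "b \<in> carr (U l)" "y = j l b"
      using rep[OF xy] by blast
    note sl = F_arrow_linear(2)[OF arr[OF a(1)]]
    show "T0 (x + y) = T0 x + T0 y"
      using T0[OF a(1,2)] T0[OF a(1) b(1)] T0[OF a(1), of "a + b"] a b
      by (simp add: linear_on_add[OF emb(1)] subspace_add subspace_Rn linear_on_add[OF sl]
          linear_on_add[OF hl linear_on_mem[OF sl] linear_on_mem[OF sl]])
  qed
  then obtain T where T: "one_bounded P norm W norm T" "\<And>x. x \<in> S \<Longrightarrow> T x = T0 x"
    using one_bounded_extension[OF sub _ W] unfolding P by blast
  show thesis
  proof (rule that[OF T(1)])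
    fix x assume x: "x \<in> carr (U m)"
    have "snd (u m m) x = x" using seq x by (auto simp: F_sequence_def F_eq_def F_id_def)
    then show "T (j m x) = h x" using T(2)[of "j m x"] T0[OF order_refl x] x by (auto simp: S_def)
  qed
qed

text \<open>The images of a basis are moved slightly into the union, hence into one stage, and the
  assignment is extended linearly. The result may have norm a little above 1, which a rescaling
  repairs.\<close>

lemma chain_approximate_embedding:
  fixes j :: "nat \<Rightarrow> fvec \<Rightarrow> 'p::banach" and E :: "'f::real_normed_vector set"
  assumes seq: "F_sequence U u" and comp: "chain_completion U u j P"
    and E: "fin_dim_subspace E" and i: "isometric_embedding E norm P norm i" and \<delta>: "\<delta> > 0"
  obtains n e where "one_bounded E norm (carr (U n)) (rnorm (U n)) e"
    "\<And>x. x \<in> E \<Longrightarrow> norm (j n (e x) - i x) \<le> \<delta> * norm x"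
proof -
  define S where "S = (\<Union>n. j n ` carr (U n))"
  have P: "P = closure S" using comp by (simp add: chain_completion_def S_def)
  note emb = chain_embedding[OF comp]
  have il: "linear_on E P i" and inorm: "\<And>x. x \<in> E \<Longrightarrow> norm (i x) = norm x"
    using i by (auto simp: isometric_embedding_def)
  obtain k \<phi> \<kappa> where c: "linear_on (Rn k) E \<phi>" "linear_on E (Rn k) \<kappa>"
    "\<And>z. z \<in> Rn k \<Longrightarrow> \<kappa> (\<phi> z) = z" "\<And>y. y \<in> E \<Longrightarrow> \<phi> (\<kappa> y) = y"
    using fin_dim_coordinates[OF E] by metis
  obtain C where C: "C > 0" "\<And>y. y \<in> E \<Longrightarrow> norm (\<kappa> y) \<le> C * norm y"
    using coordinates_bounded[OF c] by blast
  define b where "b l = i (\<phi> (Poly_Mapping.single l 1))" for l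
  \<comment> \<open>One half of \<delta> pays for moving the basis, the other for the
    rescaling.\<close>
  define \<theta> where "\<theta> = \<delta> / 2"
  have \<theta>: "\<theta> > 0" using \<delta> by (simp add: \<theta>_def)
  have i\<phi>: "linear_on (Rn k) P (\<lambda>z. i (\<phi> z))" by (rule linear_on_compose[OF c(1) il])
  \<comment> \<open>The tolerance is divided by \<open>C\<close>, which bounds the sum of the
    absolute coordinates of a unit vector; the total error is then at most
    \<open>\<theta> * norm x\<close>.\<close>
  have "\<exists>y\<in>S. dist y (b l) < \<theta> / C" if "l < k" for l
  proof -
    have "b l \<in> closure S"
      unfolding b_def P[symmetric] by (rule linear_on_mem[OF i\<phi> single_in_Rn[OF that]])
    then show ?thesis using \<theta> C(1) by (auto simp: closure_approachable)
  qed
  then obtain y where y: "\<And>l. l < k \<Longrightarrow> y l \<in> S" "\<And>l. l < k \<Longrightarrow> dist (y l) (b l) < \<theta> / C"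
    by metis
  have "\<exists>n. \<forall>m\<ge>n. y l \<in> j m ` carr (U m)" if "l < k" for l
    using chain_union_eventually[OF seq comp] y(1)[OF that] unfolding S_def by blast
  then obtain N where N: "\<And>l m. l < k \<Longrightarrow> N l \<le> m \<Longrightarrow> y l \<in> j m ` carr (U m)" by metis
  \<comment> \<open>The sum is a common upper bound of the \<open>N l\<close>, meaningful also for
    \<open>k = 0\<close>.\<close>
  define n where "n = (\<Sum>l<k. N l)"
  have "y l \<in> j n ` carr (U n)" if "l < k" for l
    by (rule N[OF that]) (use that in \<open>auto simp: n_def intro: member_le_sum\<close>)
  then have "\<forall>l. \<exists>v. l < k \<longrightarrow> v \<in> carr (U n) \<and> y l = j n v" by blast
  then obtain v where v: "\<And>l. l < k \<Longrightarrow> v l \<in> carr (U n)" "\<And>l. l < k \<Longrightarrow> y l = j n (v l)" by metis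
  define e0 where "e0 x = (\<Sum>l<k. Poly_Mapping.lookup (\<kappa> x) l *\<^sub>R v l)" for x
  have e0: "linear_on E (carr (U n)) e0"
  proof (rule linear_onI)
    show "e0 x \<in> carr (U n)" for x
      unfolding e0_def by (intro subspace_sum subspace_scale subspace_Rn v) auto
  qed (simp_all add: e0_def linear_on_add[OF c(2)] linear_on_scale[OF c(2)] lookup_add
      scaleR_add_left sum.distrib scaleR_sum_right)
  have j0: "norm (j n (e0 x) - i x) \<le> \<theta> * norm x" if x: "x \<in> E" for x
  proof -
    have \<kappa>x: "\<kappa> x \<in> Rn k" by (rule linear_on_mem[OF c(2) x])
    have "j n (e0 x) = (\<Sum>l<k. j n (Poly_Mapping.lookup (\<kappa> x) l *\<^sub>R v l))"
      unfolding e0_def by (intro linear_on_sum[OF emb(1) subspace_Rn] subspace_scale subspace_Rn v) auto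
    also have "\<dots> = (\<Sum>l<k. Poly_Mapping.lookup (\<kappa> x) l *\<^sub>R y l)"
      by (intro sum.cong refl) (simp add: v linear_on_scale[OF emb(1) v(1)])
    finally have 1: "j n (e0 x) = (\<Sum>l<k. Poly_Mapping.lookup (\<kappa> x) l *\<^sub>R y l)" .
    have "i x = i (\<phi> (\<Sum>l<k. Poly_Mapping.lookup (\<kappa> x) l *\<^sub>R Poly_Mapping.single l 1))"
      by (simp add: Rn_expansion[OF \<kappa>x] c(4)[OF x])
    also have "\<dots> = (\<Sum>l<k. i (\<phi> (Poly_Mapping.lookup (\<kappa> x) l *\<^sub>R Poly_Mapping.single l 1)))"
      by (intro linear_on_sum[OF i\<phi> subspace_Rn] subspace_scale subspace_Rn single_in_Rn) auto
    also have "\<dots> = (\<Sum>l<k. Poly_Mapping.lookup (\<kappa> x) l *\<^sub>R b l)"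
      unfolding b_def by (intro sum.cong refl linear_on_scale[OF i\<phi>] single_in_Rn) auto
    finally have "norm (j n (e0 x) - i x) = norm (\<Sum>l<k. Poly_Mapping.lookup (\<kappa> x) l *\<^sub>R (y l - b l))"
      by (simp add: 1 scaleR_diff_right sum_subtractf)
    also have "\<dots> \<le> (\<Sum>l<k. \<bar>Poly_Mapping.lookup (\<kappa> x) l\<bar> * (\<theta> / C))"
    proof (rule sum_norm_le)
      fix l assume "l \<in> {..<k}"
      then have "norm (y l - b l) \<le> \<theta> / C" using y(2)[of l] by (simp add: dist_norm)
      then show "norm (Poly_Mapping.lookup (\<kappa> x) l *\<^sub>R (y l - b l)) \<le> \<bar>Poly_Mapping.lookup (\<kappa> x) l\<bar> * (\<theta> / C)"
        by (simp add: mult_left_mono del: times_divide_eq_right)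
    qed
    also have "\<dots> = norm (\<kappa> x) * (\<theta> / C)"
      unfolding norm_Rn[OF \<kappa>x] by (rule sum_distrib_right[symmetric])
    also have "\<dots> \<le> (C * norm x) * (\<theta> / C)"
      using C(2)[OF x] C(1) \<theta> by (intro mult_right_mono) auto
    also have "\<dots> = \<theta> * norm x" using C(1) by simp
    finally show ?thesis .
  qed
  define s where "s = 1 / (1 + \<theta>)"
  have s: "0 < s" "s \<le> 1" "1 - s = s * \<theta>" using \<theta> by (auto simp: s_def field_simps)
  define e where "e x = s *\<^sub>R e0 x" for x
  have e: "linear_on E (carr (U n)) e"
    unfolding e_def by (rule linear_on_scaled[OF e0 subspace_Rn])
  have je: "j n (e x) = s *\<^sub>R j n (e0 x)" if "x \<in> E" for x
    unfolding e_def by (rule linear_on_scale[OF emb(1) linear_on_mem[OF e0 that]])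
  show thesis
  proof (rule that)
    show "one_bounded E norm (carr (U n)) (rnorm (U n)) e"
      unfolding one_bounded_def
    proof (intro conjI ballI e)
      fix x assume x: "x \<in> E"
      have "rnorm (U n) (e x) = s * norm (j n (e0 x))"
        using emb(2)[OF linear_on_mem[OF e x]] je[OF x] s by simp
      also have "norm (j n (e0 x)) \<le> norm (j n (e0 x) - i x) + norm (i x)"
        using norm_triangle_ineq[of "j n (e0 x) - i x" "i x"] by simp
      then have "s * norm (j n (e0 x)) \<le> s * (\<theta> * norm x + norm x)"
        using j0[OF x] inorm[OF x] s by (intro mult_left_mono) auto
      also have "\<dots> = norm x" using \<theta> by (simp add: s_def field_simps)
      finally show "rnorm (U n) (e x) \<le> norm x" .
    qed
    fix x assume x: "x \<in> E"
    have "norm (j n (e x) - i x) = norm (s *\<^sub>R (j n (e0 x) - i x) - (1 - s) *\<^sub>R i x)"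
      using je[OF x] by (simp add: algebra_simps)
    also have "\<dots> \<le> s * norm (j n (e0 x) - i x) + (1 - s) * norm (i x)"
      using norm_triangle_ineq4[of "s *\<^sub>R (j n (e0 x) - i x)" "(1 - s) *\<^sub>R i x"] s by simp
    also have "\<dots> \<le> s * (\<theta> * norm x) + (s * \<theta>) * norm x"
      using j0[OF x] inorm[OF x] s by (intro add_mono mult_left_mono) auto
    also have "\<dots> = s * (\<delta> * norm x)" by (simp add: \<theta>_def field_simps)
    also have "\<dots> \<le> \<delta> * norm x" using s \<delta> by (intro mult_left_le_one_le) auto
    finally show "norm (j n (e x) - i x) \<le> \<delta> * norm x" .
  qed
qed

section \<open>Amalgamation\<close>

text \<open>\<open>Rn (d + k)\<close> models the direct sum of \<open>Rn d\<close>, embedded by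
  inclusion, and \<open>Rn k\<close>, embedded by this shift. The coordinate projections are
  \<open>trunc d\<close> and \<open>shift_down d k\<close>.\<close>

definition shift_up :: "nat \<Rightarrow> nat \<Rightarrow> fvec \<Rightarrow> fvec" where
  "shift_up d k y = (\<Sum>l<d + k. (if d \<le> l then Poly_Mapping.lookup y (l - d) else 0) *\<^sub>R Poly_Mapping.single l 1)"

definition shift_down :: "nat \<Rightarrow> nat \<Rightarrow> fvec \<Rightarrow> fvec" where
  "shift_down d k z = (\<Sum>l<k. Poly_Mapping.lookup z (d + l) *\<^sub>R Poly_Mapping.single l 1)"

lemma lookup_shift_up:
  "Poly_Mapping.lookup (shift_up d k y) l = (if d \<le> l \<and> l < d + k then Poly_Mapping.lookup y (l - d) else 0)"
  by (simp add: shift_up_def lookup_lincomb)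

lemma lookup_shift_down:
  "Poly_Mapping.lookup (shift_down d k z) l = (if l < k then Poly_Mapping.lookup z (d + l) else 0)"
  by (simp add: shift_down_def lookup_lincomb)

lemma linear_shift_up: "linear (shift_up d k)"
  by (rule linearI) (auto intro!: poly_mapping_eqI simp: lookup_shift_up lookup_add)

lemma linear_shift_down: "linear (shift_down d k)"
  by (rule linearI) (auto intro!: poly_mapping_eqI simp: lookup_shift_down lookup_add)

lemma shift_up_in_Rn: "shift_up d k y \<in> Rn (d + k)"
  by (auto simp: Rn_def lookup_shift_up)

lemma shift_down_in_Rn: "shift_down d k z \<in> Rn k"
  by (auto simp: Rn_def lookup_shift_down)

lemma shift_down_up: "y \<in> Rn k \<Longrightarrow> shift_down d k (shift_up d k y) = y"
  by (rule poly_mapping_eqI) (auto simp: lookup_shift_up lookup_shift_down Rn_def)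

lemma shift_down_Rn: "w \<in> Rn d \<Longrightarrow> shift_down d k w = 0"
  by (rule poly_mapping_eqI) (auto simp: lookup_shift_down Rn_def)

lemma trunc_shift_up: "trunc d (shift_up d k y) = 0"
  by (rule poly_mapping_eqI) (auto simp: lookup_shift_up lookup_trunc)

lemma trunc_shift_down_eq_0:
  assumes "z \<in> Rn (d + k)" "trunc d z = 0" "shift_down d k z = 0"
  shows "z = 0"
proof (rule poly_mapping_eqI)
  fix l
  have "l < d \<Longrightarrow> Poly_Mapping.lookup z l = 0"
    using arg_cong[OF assms(2), of "\<lambda>z. Poly_Mapping.lookup z l"] by (simp add: lookup_trunc)
  moreover have "d \<le> l \<Longrightarrow> l < d + k \<Longrightarrow> Poly_Mapping.lookup z l = 0"
    using arg_cong[OF assms(3), of "\<lambda>z. Poly_Mapping.lookup z (l - d)"] by (simp add: lookup_shift_down less_diff_conv2)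
  moreover have "d + k \<le> l \<Longrightarrow> Poly_Mapping.lookup z l = 0"
    using assms(1) by (simp add: Rn_def)
  ultimately show "Poly_Mapping.lookup z l = Poly_Mapping.lookup 0 l"
    by (cases "l < d"; cases "l < d + k") auto
qed

text \<open>A point with coordinates \<open>w\<close>, \<open>y\<close> stands for the pair
  \<open>(w, \<phi> y + p w)\<close> in the maximum sum of \<open>U\<close> and \<open>F\<close>. In
  this description \<open>U\<close> is the first summand and its projection is truncation, so the
  arrow is rational; the arbitrary real maps enter only \<iota> and \<rho>, which are not
  arrows.\<close>

lemma rational_amalgam:
  fixes E F :: "'f::real_normed_vector set"
  assumes U: "rational_space U" and F: "fin_dim_subspace F" and E: "subspace E" "E \<subseteq> F"
    and e: "one_bounded E norm (carr U) (rnorm U) e"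
    and p: "one_bounded (carr U) (rnorm U) E norm p"
    and \<pi>: "one_bounded F norm E norm \<pi>" "\<And>x. x \<in> E \<Longrightarrow> \<pi> x = x"
    and pe: "\<And>x. x \<in> E \<Longrightarrow> norm (p (e x) - x) \<le> \<delta> * norm x"
    and \<eta>: "0 < \<eta>" "\<eta> < 1"
  obtains Y f \<iota> \<rho> where "rational_space Y" "F_arrow U Y f"
    "linear_on F (carr Y) \<iota>" "one_bounded (carr Y) (rnorm Y) F norm \<rho>"
    "\<And>x. x \<in> F \<Longrightarrow> \<rho> (\<iota> x) = x" "\<And>x. x \<in> F \<Longrightarrow> (1 - \<eta>) * rnorm Y (\<iota> x) \<le> norm x"
    "\<And>x. x \<in> E \<Longrightarrow> (1 - \<eta>) * rnorm Y (\<iota> x - fst f (e x)) \<le> \<delta> * norm x"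
proof -
  define d where "d = rdim U"
  have nU: "norm_on (Rn d) (rnorm U)" using U by (simp add: rational_space_def d_def)
  have sF: "subspace F" using F by (simp add: fin_dim_subspace_def)
  have el: "linear_on E (Rn d) e" and eb: "\<And>x. x \<in> E \<Longrightarrow> rnorm U (e x) \<le> norm x"
    using e by (auto simp: one_bounded_def d_def)
  have pl: "linear_on (Rn d) E p" and pb: "\<And>x. x \<in> Rn d \<Longrightarrow> norm (p x) \<le> rnorm U x"
    using p by (auto simp: one_bounded_def d_def)
  have \<pi>l: "linear_on F E \<pi>" and \<pi>b: "\<And>x. x \<in> F \<Longrightarrow> norm (\<pi> x) \<le> norm x"
    using \<pi>(1) by (auto simp: one_bounded_def)
  obtain k \<phi> \<kappa> where c: "linear_on (Rn k) F \<phi>" "linear_on F (Rn k) \<kappa>"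
    "\<And>z. z \<in> Rn k \<Longrightarrow> \<kappa> (\<phi> z) = z" "\<And>y. y \<in> F \<Longrightarrow> \<phi> (\<kappa> y) = y"
    using fin_dim_coordinates[OF F] by metis
  define Z where "Z = Rn (d + k)"
  have sZ: "subspace Z" unfolding Z_def by (rule subspace_Rn)
  have dZ: "Rn d \<subseteq> Z" unfolding Z_def by (rule Rn_mono) simp
  have tr: "linear_on Z (Rn d) (trunc d)"
    by (rule linear_imp_linear_on[OF linear_trunc]) (auto simp: trunc_in_Rn)
  have dn: "linear_on Z (Rn k) (shift_down d k)"
    by (rule linear_imp_linear_on[OF linear_shift_down]) (auto simp: shift_down_in_Rn)
  have up: "linear_on (Rn k) Z (shift_up d k)"
    unfolding Z_def by (rule linear_imp_linear_on[OF linear_shift_up]) (auto simp: shift_up_in_Rn)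
  \<comment> \<open>The second entry of the pair represented by \<open>z\<close>.\<close>
  define \<rho> where "\<rho> z = \<phi> (shift_down d k z) + p (trunc d z)" for z
  have \<rho>l: "linear_on Z F \<rho>"
    unfolding \<rho>_def
    by (intro linear_on_plus linear_on_compose[OF dn c(1)] linear_on_subset[OF linear_on_compose[OF tr pl]]
        order_refl E sF)
  define N where "N z = max (rnorm U (trunc d z)) (norm (\<rho> z))" for z
  have N: "norm_on Z N"
    unfolding N_def
  proof (rule norm_on_max[OF tr nU \<rho>l norm_on_norm _ sZ])
    fix z assume z: "z \<in> Z" "trunc d z = 0" "\<rho> z = 0"
    then have "\<phi> (shift_down d k z) = 0"
      by (simp add: \<rho>_def linear_on_zero[OF pl subspace_Rn])
    then have "shift_down d k z = 0"
      using c(3)[OF shift_down_in_Rn, of d z] linear_on_zero[OF c(2) sF] by simp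
    then show "z = 0" using trunc_shift_down_eq_0 z unfolding Z_def by blast
  qed
  have \<rho>d: "\<rho> w = p w" if "w \<in> Rn d" for w
    using that by (simp add: \<rho>_def trunc_Rn shift_down_Rn linear_on_zero[OF c(1) subspace_Rn])
  \<comment> \<open>A vector \<open>w\<close> of \<open>U\<close> represents
    \<open>(w, p w)\<close>, whose maximum norm is that of \<open>w\<close> because \<open>p\<close>
    is 1-bounded.\<close>
  have NU: "N w \<le> rnorm U w" if "w \<in> Rn d" for w
    using \<rho>d[OF that] pb[OF that] that by (simp add: N_def trunc_Rn)
  obtain Y where Y: "rational_space Y" "rdim Y = d + k" "F_arrow U Y (id, trunc d)"
    "\<And>z. z \<in> Z \<Longrightarrow> N z \<le> rnorm Y z" "\<And>z. z \<in> Z \<Longrightarrow> rnorm Y z \<le> N z / (1 - \<eta>)"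
    using rational_extension[OF U N[unfolded Z_def d_def] NU[unfolded d_def] _ \<eta>]
    unfolding d_def[symmetric] Z_def N_def by (metis max.cobounded1)
  define \<sigma> where "\<sigma> x = shift_up d k (\<kappa> x)" for x
  have \<sigma>l: "linear_on F Z \<sigma>" unfolding \<sigma>_def by (rule linear_on_compose[OF c(2) up])
  have \<sigma>tr: "trunc d (\<sigma> x) = 0" for x by (simp add: \<sigma>_def trunc_shift_up)
  have \<sigma>\<rho>: "\<rho> (\<sigma> x) = x" if "x \<in> F" for x
    using that linear_on_mem[OF c(2) that]
    by (simp add: \<rho>_def trunc_shift_up \<sigma>_def shift_down_up c(4) linear_on_zero[OF pl subspace_Rn])
  have e\<pi>: "linear_on F (Rn d) (\<lambda>x. e (\<pi> x))" by (rule linear_on_compose[OF \<pi>l el])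
  have pe\<pi>: "linear_on F F (\<lambda>x. x - p (e (\<pi> x)))"
    by (rule linear_on_minus[OF _ linear_on_subset[OF linear_on_compose[OF e\<pi> pl]] sF])
      (use E in \<open>auto simp: linear_on_def\<close>)
  \<comment> \<open>The pair represented is \<open>(e (\<pi> x), x)\<close>: the first term
    contributes \<open>(e (\<pi> x), p (e (\<pi> x)))\<close>, and \<sigma>, which represents
    \<open>(0, x)\<close>, corrects the second entry.\<close>
  define \<iota> where "\<iota> x = e (\<pi> x) + \<sigma> (x - p (e (\<pi> x)))" for x
  have \<iota>l: "linear_on F Z \<iota>"
    unfolding \<iota>_def
    by (intro linear_on_plus linear_on_subset[OF e\<pi> order_refl dZ] linear_on_compose[OF pe\<pi> \<sigma>l] sZ)
  have \<iota>\<rho>: "\<rho> (\<iota> x) = x" if x: "x \<in> F" for x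
  proof -
    have "\<rho> (\<iota> x) = p (e (\<pi> x)) + (x - p (e (\<pi> x)))"
      unfolding \<iota>_def
      using linear_on_mem[OF e\<pi> x] linear_on_mem[OF pe\<pi> x] linear_on_mem[OF \<sigma>l] dZ
      by (subst linear_on_add[OF \<rho>l]) (auto simp: \<rho>d \<sigma>\<rho>)
    then show ?thesis by simp
  qed
  have \<iota>tr: "trunc d (\<iota> x) = e (\<pi> x)" if x: "x \<in> F" for x
    using linear_on_mem[OF e\<pi> x] by (simp add: \<iota>_def linear_add[OF linear_trunc] \<sigma>tr trunc_Rn)
  have N\<iota>: "N (\<iota> x) \<le> norm x" if x: "x \<in> F" for x
    using eb[OF linear_on_mem[OF \<pi>l x]] \<pi>b[OF x] by (simp add: N_def \<iota>tr[OF x] \<iota>\<rho>[OF x])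
  have scaled: "(1 - \<eta>) * rnorm Y z \<le> N z" if "z \<in> Z" for z
    using Y(5)[OF that] \<eta> by (simp add: field_simps)
  have cY: "carr Y = Z" by (simp add: Y(2) Z_def)
  show thesis
  proof (rule that)
    show "rational_space Y" "F_arrow U Y (id, trunc d)" by (rule Y)+
    show "linear_on F (carr Y) \<iota>" unfolding cY by (rule \<iota>l)
    show "one_bounded (carr Y) (rnorm Y) F norm \<rho>"
      unfolding cY one_bounded_def
    proof (intro conjI ballI \<rho>l)
      fix z assume "z \<in> Z"
      then show "norm (\<rho> z) \<le> rnorm Y z" using Y(4)[of z] by (simp add: N_def)
    qed
    fix x
    show "\<rho> (\<iota> x) = x" if "x \<in> F" by (rule \<iota>\<rho>[OF that])
    show "(1 - \<eta>) * rnorm Y (\<iota> x) \<le> norm x" if "x \<in> F"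
      using scaled[OF linear_on_mem[OF \<iota>l that]] N\<iota>[OF that] by linarith
    assume x: "x \<in> E"
    have xF: "x \<in> F" "x - p (e x) \<in> F" "e x \<in> Rn d"
      using x E \<pi>(2)[OF x] linear_on_mem[OF pe\<pi>, of x] linear_on_mem[OF el x] by auto
    \<comment> \<open>On \<open>E\<close> the first entries cancel since \<open>\<pi> x = x\<close>;
      what remains is the pair \<open>(0, x - p (e x))\<close>, which is small by
      \<open>pe\<close>.\<close>
    have "\<iota> x - fst (id, trunc d) (e x) = \<sigma> (x - p (e x))"
      by (simp add: \<iota>_def \<pi>(2)[OF x])
    moreover have "N (\<sigma> (x - p (e x))) = norm (p (e x) - x)"
      using norm_on_eq_0[OF nU subspace_0[OF subspace_Rn]]
      by (simp add: N_def \<sigma>tr \<sigma>\<rho>[OF xF(2)] norm_minus_commute)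
    ultimately show "(1 - \<eta>) * rnorm Y (\<iota> x - fst (id, trunc d) (e x)) \<le> \<delta> * norm x"
      using scaled[OF linear_on_mem[OF \<sigma>l xF(2)]] pe[OF x] by simp
  qed
qed

section \<open>The extension property of the completion\<close>

theorem theorem7p1:
  fixes U :: "nat \<Rightarrow> rspace" and u :: "nat \<Rightarrow> nat \<Rightarrow> arrow"
    and j :: "nat \<Rightarrow> fvec \<Rightarrow> 'p::banach" and P :: "'p set"
    and E F :: "'f::real_normed_vector set" and i :: "'f \<Rightarrow> 'p" and \<epsilon> :: real
  assumes "fraisse_sequence U u"
    and "chain_completion U u j P"
    and "fin_dim_subspace F" and "fin_dim_subspace E" and "E \<subseteq> F"
    and "one_complemented E F"
    and "isometric_embedding E norm P norm i"
    and "one_complemented (i ` E) P"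
    and "\<epsilon> > 0"
  shows "\<exists>g. eps_isometric_embedding \<epsilon> F P g \<and> onorm_on E (\<lambda>x. g x - i x) < \<epsilon> \<and>
           one_eps_complemented \<epsilon> (g ` F) P"
proof -
  have seq: "F_sequence U u" using assms(1) by (simp add: fraisse_sequence_def)
  note comp = assms(2)
  note emb = chain_embedding[OF comp]
  have sF: "subspace F" and sE: "subspace E" using assms(3,4) by (auto simp: fin_dim_subspace_def)
  \<comment> \<open>The distance from \<open>g\<close> to \<open>i\<close> will be at most
    \<open>3 * \<eta>\<close>, so a quarter of \<epsilon> gives strict inequality. The bound 1/2
    keeps \<open>1 - \<eta>\<close> positive for large \<epsilon>.\<close>
  define \<eta> where "\<eta> = min (\<epsilon> / 4) (1 / 2)"
  have \<eta>: "0 < \<eta>" "\<eta> < 1" "\<eta> \<le> \<epsilon> / 4" using assms(9) by (auto simp: \<eta>_def)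
  have il: "linear_on E P i" and inorm: "\<And>x. x \<in> E \<Longrightarrow> norm (i x) = norm x"
    using assms(7) by (auto simp: isometric_embedding_def)
  obtain \<pi> where \<pi>: "one_bounded F norm E norm \<pi>" "\<And>x. x \<in> E \<Longrightarrow> \<pi> x = x"
    using assms(6) by (auto simp: one_complemented_def)
  obtain R where R: "one_bounded P norm (i ` E) norm R" "\<And>y. y \<in> i ` E \<Longrightarrow> R y = y"
    using assms(8) by (auto simp: one_complemented_def)
  have Rl: "linear_on P (i ` E) R" and Rb: "\<And>y. y \<in> P \<Longrightarrow> norm (R y) \<le> norm y"
    using R(1) by (auto simp: one_bounded_def)
  have sP: "subspace P"
    using closure_of_subspace[OF chain_union_subspace[OF seq comp]] comp by (simp add: chain_completion_def)
  obtain n e where e: "one_bounded E norm (carr (U n)) (rnorm (U n)) e"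
    "\<And>x. x \<in> E \<Longrightarrow> norm (j n (e x) - i x) \<le> \<eta> * norm x"
    using chain_approximate_embedding[OF seq comp assms(4,7) \<eta>(1)] by metis
  have el: "linear_on E (carr (U n)) e" and eb: "\<And>x. x \<in> E \<Longrightarrow> rnorm (U n) (e x) \<le> norm x"
    using e(1) by (auto simp: one_bounded_def)
  have rU: "rational_space (U n)" using seq by (simp add: F_sequence_def)

  have inj: "inj_on i E"
  proof (rule inj_onI)
    fix x y assume xy: "x \<in> E" "y \<in> E" "i x = i y"
    then have "norm (x - y) = 0"
      using inorm[of "x - y"] linear_on_diff[OF il sE xy(1,2)] sE by (simp add: subspace_diff)
    then show "x = y" by simp
  qed
  \<comment> \<open>The retraction \<open>R\<close> takes values in the image of \<open>i\<close>;
    pulling back along the isometry \<open>i\<close> gives an operator into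
    \<open>E\<close>.\<close>
  define p where "p w = the_inv_into E i (R (j n w))" for w
  have Rj: "linear_on (carr (U n)) (i ` E) (\<lambda>w. R (j n w))"
    by (rule linear_on_compose[OF emb(1) Rl])
  have pE: "p w \<in> E" and ip: "i (p w) = R (j n w)" if "w \<in> carr (U n)" for w
    using linear_on_mem[OF Rj that] inj
    by (auto simp: p_def f_the_inv_into_f intro: the_inv_into_into)
  have p_eq: "p w = x" if "x \<in> E" "w \<in> carr (U n)" "i x = R (j n w)" for w x
    using inj_onD[OF inj _ pE[OF that(2)] that(1)] that ip by metis
  have p: "one_bounded (carr (U n)) (rnorm (U n)) E norm p"
    unfolding one_bounded_def
  proof (intro conjI ballI linear_onI)
    fix x assume x: "x \<in> carr (U n)"
    show "p x \<in> E" by (rule pE[OF x])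
    show "norm (p x) \<le> rnorm (U n) x"
      using Rb[OF linear_on_mem[OF emb(1) x]] inorm[OF pE[OF x]] ip[OF x] emb(2)[OF x] by simp
    show "p (c *\<^sub>R x) = c *\<^sub>R p x" for c
      using x pE[OF x] sE
      by (intro p_eq) (auto simp: subspace_scale subspace_Rn linear_on_scale[OF il] linear_on_scale[OF Rj] ip)
  next
    fix x y assume xy: "x \<in> carr (U n)" "y \<in> carr (U n)"
    show "p (x + y) = p x + p y"
      using xy pE[OF xy(1)] pE[OF xy(2)] sE
      by (intro p_eq) (auto simp: subspace_add subspace_Rn linear_on_add[OF il] linear_on_add[OF Rj] ip)
  qed
  \<comment> \<open>Since \<open>R\<close> fixes \<open>i x\<close>, the isometry \<open>i\<close>
    carries \<open>p (e x) - x\<close> to the \<open>R\<close>-image of the approximation error of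
    \<open>e\<close>.\<close>
  have pe: "norm (p (e x) - x) \<le> \<eta> * norm x" if x: "x \<in> E" for x
  proof -
    have ex: "e x \<in> carr (U n)" by (rule linear_on_mem[OF el x])
    have "norm (p (e x) - x) = norm (i (p (e x) - x))"
      by (rule inorm[symmetric]) (use pE[OF ex] x sE in \<open>auto simp: subspace_diff\<close>)
    also have "i (p (e x) - x) = R (j n (e x)) - R (i x)"
      using linear_on_diff[OF il sE pE[OF ex] x] ip[OF ex] R(2)[of "i x"] x by simp
    also have "\<dots> = R (j n (e x) - i x)"
      by (rule linear_on_diff[OF Rl sP linear_on_mem[OF emb(1) ex] linear_on_mem[OF il x], symmetric])
    also have "norm \<dots> \<le> norm (j n (e x) - i x)"
      by (intro Rb subspace_diff sP linear_on_mem[OF emb(1) ex] linear_on_mem[OF il x])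
    also have "\<dots> \<le> \<eta> * norm x" by (rule e(2)[OF x])
    finally show ?thesis .
  qed

  obtain Y f \<iota> \<rho> where Y: "rational_space Y" "F_arrow (U n) Y f"
    and \<iota>: "linear_on F (carr Y) \<iota>" and \<rho>: "one_bounded (carr Y) (rnorm Y) F norm \<rho>"
    and \<iota>\<rho>: "\<And>x. x \<in> F \<Longrightarrow> \<rho> (\<iota> x) = x"
    and \<iota>b: "\<And>x. x \<in> F \<Longrightarrow> (1 - \<eta>) * rnorm Y (\<iota> x) \<le> norm x"
    and \<iota>e: "\<And>x. x \<in> E \<Longrightarrow> (1 - \<eta>) * rnorm Y (\<iota> x - fst f (e x)) \<le> \<eta> * norm x"
    using rational_amalgam[OF rU assms(3) sE assms(5) e(1) p \<pi> pe \<eta>(1,2)] by metis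
  have \<rho>l: "linear_on (carr Y) F \<rho>" and \<rho>b: "\<And>z. z \<in> carr Y \<Longrightarrow> norm (\<rho> z) \<le> rnorm Y z"
    using \<rho> by (auto simp: one_bounded_def)
  obtain m q where m: "n < m" "F_arrow Y (U m) q" "F_eq (U n) (U m) (F_comp q f) (u n m)"
    using assms(1) Y unfolding fraisse_sequence_def by meson
  note ql = F_arrow_linear[OF m(2)] and qn = F_arrow_norm[OF m(2)]
  have jq: "linear_on (carr Y) P (\<lambda>z. j m (fst q z))"
    by (rule linear_on_compose[OF ql(1) emb(1)])
  have jqn: "norm (j m (fst q z)) = rnorm Y z" if "z \<in> carr Y" for z
    using emb(2)[OF linear_on_mem[OF ql(1) that]] qn(1)[OF that] by simp
  \<comment> \<open>The map \<iota> may stretch by up to \<open>1 / (1 - \<eta>)\<close>, the price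
    of the rational polytope; the factor restores the bound 1.\<close>
  define g where "g x = (1 - \<eta>) *\<^sub>R j m (fst q (\<iota> x))" for x
  have gl: "linear_on F P g"
    unfolding g_def by (rule linear_on_scaled[OF linear_on_compose[OF \<iota> jq] sP])
  have gn: "norm (g x) = (1 - \<eta>) * rnorm Y (\<iota> x)" if "x \<in> F" for x
    using jqn[OF linear_on_mem[OF \<iota> that]] \<eta> by (simp add: g_def)
  have gb: "norm (g x) \<le> norm x" if "x \<in> F" for x
    using gn[OF that] \<iota>b[OF that] by simp
  have g_iso: "eps_isometric_embedding \<epsilon> F P g"
    unfolding eps_isometric_embedding_def
  proof (intro conjI ballI gl gb)
    fix x assume x: "x \<in> F"
    have "(1 - \<epsilon>) * norm x \<le> (1 - \<eta>) * norm x"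
      using \<eta> assms(9) by (intro mult_right_mono) auto
    \<comment> \<open>\<iota> has the 1-bounded left inverse \<rho>, so only the scaling factor is
      lost.\<close>
    also have "norm x \<le> rnorm Y (\<iota> x)"
      using \<rho>b[OF linear_on_mem[OF \<iota> x]] \<iota>\<rho>[OF x] by simp
    then have "(1 - \<eta>) * norm x \<le> (1 - \<eta>) * rnorm Y (\<iota> x)"
      using \<eta> by (intro mult_left_mono) auto
    also have "\<dots> = norm (g x)" using gn[OF x] by simp
    finally show "(1 - \<epsilon>) * norm x \<le> norm (g x)" .
  qed

  have gi: "norm (g x - i x) \<le> (3 * \<eta>) * norm x" if x: "x \<in> E" for x
  proof -
    have xF: "x \<in> F" using x assms(5) by auto
    have ex: "e x \<in> carr (U n)" by (rule linear_on_mem[OF el x])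
    have fex: "fst f (e x) \<in> carr Y" by (rule linear_on_mem[OF F_arrow_linear(1)[OF Y(2)] ex])
    \<comment> \<open>By the Fraisse property the copy of \<open>U n\<close> reached through
      \<open>Y\<close> is the original one, so \<open>g x\<close> and \<open>j n (e x)\<close> can
      be compared inside \<open>Y\<close>.\<close>
    have "j n (e x) = j m (fst q (fst f (e x)))"
      using emb(3)[OF less_imp_le[OF m(1)] ex] m(3) ex by (simp add: F_eq_def F_comp_def)
    then have "g x - (1 - \<eta>) *\<^sub>R j n (e x) = (1 - \<eta>) *\<^sub>R j m (fst q (\<iota> x - fst f (e x)))"
      using linear_on_diff[OF jq subspace_Rn linear_on_mem[OF \<iota> xF] fex]
      by (simp add: g_def scaleR_diff_right)
    then have 1: "norm (g x - (1 - \<eta>) *\<^sub>R j n (e x)) \<le> \<eta> * norm x"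
      using jqn[OF subspace_diff[OF subspace_Rn linear_on_mem[OF \<iota> xF] fex]] \<iota>e[OF x] \<eta> by simp
    have 2: "norm (\<eta> *\<^sub>R j n (e x)) \<le> \<eta> * norm x"
      using emb(2)[OF ex] eb[OF x] \<eta> by simp
    \<comment> \<open>Three errors of size \<eta> each: the gap inside \<open>Y\<close>, the
      approximation of \<open>i\<close> by \<open>e\<close>, and the scaling of
      \<open>j n (e x)\<close>.\<close>
    have "norm (g x - i x) = norm ((g x - (1 - \<eta>) *\<^sub>R j n (e x)) + ((j n (e x) - i x) - \<eta> *\<^sub>R j n (e x)))"
      by (simp add: scaleR_diff_left)
    also have "\<dots> \<le> norm (g x - (1 - \<eta>) *\<^sub>R j n (e x)) + norm ((j n (e x) - i x) - \<eta> *\<^sub>R j n (e x))"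
      by (rule norm_triangle_ineq)
    also have "norm ((j n (e x) - i x) - \<eta> *\<^sub>R j n (e x)) \<le> norm (j n (e x) - i x) + norm (\<eta> *\<^sub>R j n (e x))"
      by (rule norm_triangle_ineq4)
    finally show ?thesis using 1 2 e(2)[OF x] by simp
  qed
  have "onorm_on E (\<lambda>x. g x - i x) \<le> 3 * \<eta>"
    unfolding onorm_on_def
  proof (rule cSUP_least)
    show "E \<noteq> {}" using subspace_0[OF sE] by auto
    show "norm (g x - i x) / norm x \<le> 3 * \<eta>" if "x \<in> E" for x
      using gi[OF that] \<eta>(1) by (cases "x = 0") (auto simp: divide_le_eq)
  qed
  then have close: "onorm_on E (\<lambda>x. g x - i x) < \<epsilon>" using \<eta>(3) assms(9) by linarith

  \<comment> \<open>From stage \<open>m\<close> back to \<open>Y\<close>, then to \<open>F\<close>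
    by \<rho>, then forward by \<open>g\<close>. On the unscaled image of \<iota> in
    \<open>U m\<close> this yields \<open>g\<close>.\<close>
  define h where "h x = g (\<rho> (snd q x))" for x
  have "linear_on (carr (U m)) (g ` F) h"
    unfolding h_def
    by (intro linear_on_compose[OF linear_on_compose[OF ql(2) \<rho>l]]) (use gl in \<open>auto simp: linear_on_def\<close>)
  moreover have "norm (h x) \<le> rnorm (U m) x" if x: "x \<in> carr (U m)" for x
    using gb[OF linear_on_mem[OF linear_on_compose[OF ql(2) \<rho>l] x]]
      \<rho>b[OF linear_on_mem[OF ql(2) x]] qn(2)[OF x] unfolding h_def by linarith
  ultimately have h: "one_bounded (carr (U m)) (rnorm (U m)) (g ` F) norm h"
    by (simp add: one_bounded_def)
  obtain T where T: "one_bounded P norm (g ` F) norm T" "\<And>x. x \<in> carr (U m) \<Longrightarrow> T (j m x) = h x"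
    using chain_projection[OF seq comp h closed_fin_dim_subspace[OF fin_dim_subspace_image[OF assms(3) gl]]]
    by metis
  have Tl: "linear_on P (g ` F) T" using T(1) by (simp add: one_bounded_def)
  \<comment> \<open>The rescaling makes \<open>T\<close> equal to \<open>1 - \<eta>\<close> times
    the identity on the range of \<open>g\<close>, so the complementation there is only approximate,
    with error \<eta>.\<close>
  have Tg: "T (g x) = (1 - \<eta>) *\<^sub>R g x" if x: "x \<in> F" for x
  proof -
    have \<iota>x: "\<iota> x \<in> carr Y" by (rule linear_on_mem[OF \<iota> x])
    have "T (g x) = (1 - \<eta>) *\<^sub>R T (j m (fst q (\<iota> x)))"
      unfolding g_def by (rule linear_on_scale[OF Tl linear_on_mem[OF jq \<iota>x]])
    also have "T (j m (fst q (\<iota> x))) = g x"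
      using T(2)[OF linear_on_mem[OF ql(1) \<iota>x]] F_arrow_retract[OF m(2) \<iota>x] \<iota>\<rho>[OF x]
      by (simp add: h_def)
    finally show ?thesis .
  qed
  have "one_eps_complemented \<epsilon> (g ` F) P"
    unfolding one_eps_complemented_def
  proof (intro conjI exI[of _ T] T(1) ballI)
    show "subspace (g ` F)" by (rule subspace_image_linear_on[OF gl sF])
    show "g ` F \<subseteq> P" using gl by (simp add: linear_on_def)
    fix y assume "y \<in> g ` F"
    then have "T y - y = - \<eta> *\<^sub>R y" using Tg by (auto simp: scaleR_diff_left)
    then have "norm (T y - y) = \<eta> * norm y" using \<eta> by simp
    also have "\<dots> \<le> \<epsilon> * norm y" using \<eta> assms(9) by (intro mult_right_mono) auto
    finally show "norm (T y - y) \<le> \<epsilon> * norm y" .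
  qed
  with g_iso close show ?thesis by blast
qed

end
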